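(* Let $\mathcal{A}$ be a Banach algebra and let $\sigma\in Hom(\mathcal{A})$. Then: (i) If $\mathcal{A}$ is biflat, then $\mathcal{A}$ is $\sigma$-biflat. (ii) If $\mathcal{A}$ is $\sigma$-biflat and has a bounded approximate identity, and if $\sigma$ has dense range, then $\mathcal{A}$ is biflat.
   Context: $Hom(\mathcal{A})$ is the set of all continuous algebra homomorphisms $\mathcal{A}\to\mathcal{A}$. The projective tensor product $\mathcal{A}\widehat{\otimes}\mathcal{A}$ is a Banach $\mathcal{A}$-bimodule via $a\cdot(b\otimes c)=ab\otimes c$ and $(b\otimes c)\cdot a=b\otimes ca$. The diagonal operator is $\pi:\mathcal{A}\widehat{\otimes}\mathcal{A}\to\mathcal{A}$, $\pi(a\otimes b)=ab$. For a Banach $\mathcal{A}$-bimodule $X$, the dual $X^*$ is a Banach $\mathcal{A}$-bimodule via $\langle a\cdot\lambda,x\rangle=\langle\lambda,x\cdot a\rangle$ and $\langle\lambda\cdot a,x\rangle=\langle\lambda,a\cdot x\rangle$. $\mathcal{A}$ is biflat if there is a bounded $\mathcal{A}$-bimodule homomorphism $(\mathcal{A}\widehat{\otimes}\mathcal{A})^*\to\mathcal{A}^*$ which is a left inverse of $\pi^*$. $\mathcal{A}$ is $\sigma$-biflat if there exists a bounded linear map $\rho:(\mathcal{A}\widehat{\otimes}\mathcal{A})^*\to\mathcal{A}^*$ such that $\rho(\sigma(a)\cdot\lambda)=a\cdot\rho(\lambda)$ and $\rho(\lambda\cdot\sigma(a))=\rho(\lambda)\cdot a$ for all $a\in\mathcal{A}$,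 $\lambda\in(\mathcal{A}\widehat{\otimes}\mathcal{A})^*$, and $\rho\circ\pi^*=\sigma^*$. *)

theory Defs
  imports "HOL-Analysis.Analysis"
begin

section \<open>Complex Banach spaces and Banach algebras\<close>

class complex_vector = real_vector +
  fixes scaleC :: "complex \<Rightarrow> 'a \<Rightarrow> 'a"  (infixr \<open>*\<^sub>C\<close> 75)
  assumes scaleC_add_right: "c *\<^sub>C (x + y) = c *\<^sub>C x + c *\<^sub>C y"
    and scaleC_add_left: "(c + d) *\<^sub>C x = c *\<^sub>C x + d *\<^sub>C x"
    and scaleC_scaleC: "c *\<^sub>C d *\<^sub>C x = (c * d) *\<^sub>C x"
    and scaleC_one: "1 *\<^sub>C x = x"
    and scaleC_of_real: "complex_of_real r *\<^sub>C x = r *\<^sub>R x"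

class complex_normed_vector = complex_vector + real_normed_vector +
  assumes norm_scaleC: "norm (c *\<^sub>C x) = cmod c * norm x"

class complex_banach = complex_normed_vector + banach

class complex_banach_algebra = complex_banach + real_normed_algebra +
  assumes scaleC_mult_left: "(c *\<^sub>C x) * y = c *\<^sub>C (x * y)"
    and scaleC_mult_right: "x * (c *\<^sub>C y) = c *\<^sub>C (x * y)"

instantiation complex :: complex_banach_algebra
begin

definition scaleC_complex :: "complex \<Rightarrow> complex \<Rightarrow> complex"
  where "scaleC_complex c x = c * x"

instance
  by standard (auto simp: scaleC_complex_def algebra_simps norm_mult scaleR_conv_of_real)

end

definition clinear :: "('a::complex_vector \<Rightarrow> 'b::complex_vector) \<Rightarrow> bool"
  where "clinear f \<longleftrightarrow> (\<forall>x y. f (x + y) = f x + f y) \<and> (\<forall>c x. f (c *\<^sub>C x) = c *\<^sub>C f x)"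

definition bounded_clinear :: "('a::complex_normed_vector \<Rightarrow> 'b::complex_normed_vector) \<Rightarrow> bool"
  where "bounded_clinear f \<longleftrightarrow> clinear f \<and> (\<exists>K. \<forall>x. norm (f x) \<le> K * norm x)"

definition bounded_cbilinear ::
    "('a::complex_normed_vector \<Rightarrow> 'b::complex_normed_vector \<Rightarrow> 'c::complex_normed_vector) \<Rightarrow> bool"
  where "bounded_cbilinear B \<longleftrightarrow> (\<forall>b. clinear (\<lambda>a. B a b)) \<and> (\<forall>a. clinear (B a)) \<and>
    (\<exists>K. \<forall>a b. norm (B a b) \<le> K * (norm a * norm b))"

lemma clinear_add: "clinear f \<Longrightarrow> f (x + y) = f x + f y"
  and clinear_scaleC: "clinear f \<Longrightarrow> f (c *\<^sub>C x) = c *\<^sub>C f x"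
  by (auto simp: clinear_def)

lemma scaleC_zero_left [simp]: "0 *\<^sub>C x = (0 :: 'a::complex_vector)"
  using scaleC_of_real[of 0 x] by simp

lemma scaleC_minus_one: "(- 1) *\<^sub>C x = - (x :: 'a::complex_vector)"
  using scaleC_of_real[of "-1" x] by simp

lemma clinear_imp_linear: "clinear f \<Longrightarrow> linear f"
  by (auto simp: clinear_def linear_iff simp flip: scaleC_of_real)

lemma clinear_zero: "clinear f \<Longrightarrow> f 0 = 0"
  by (simp add: linear_0 clinear_imp_linear)

lemma clinear_diff: "clinear f \<Longrightarrow> f (x - y) = f x - f y"
  by (simp add: linear_diff clinear_imp_linear)

lemma bounded_clinear_iff:
  "bounded_clinear f \<longleftrightarrow> bounded_linear f \<and> (\<forall>c x. f (c *\<^sub>C x) = c *\<^sub>C f x)"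
proof
  assume f: "bounded_clinear f"
  then obtain K where "\<And>x. norm (f x) \<le> K * norm x"
    by (auto simp: bounded_clinear_def)
  then show "bounded_linear f \<and> (\<forall>c x. f (c *\<^sub>C x) = c *\<^sub>C f x)"
    using f clinear_imp_linear[of f]
    by (auto simp: bounded_clinear_def clinear_def bounded_linear_def bounded_linear_axioms_def
        mult.commute)
next
  assume f: "bounded_linear f \<and> (\<forall>c x. f (c *\<^sub>C x) = c *\<^sub>C f x)"
  then interpret bounded_linear f by simp
  from nonneg_bounded obtain K where "\<And>x. norm (f x) \<le> norm x * K" by auto
  then show "bounded_clinear f"
    using f by (auto simp: bounded_clinear_def clinear_def add mult.commute)
qed

lemma bounded_clinear_clinear: "bounded_clinear f \<Longrightarrow> clinear f"
  by (simp add: bounded_clinear_def)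

lemma bounded_clinear_bounded_linear: "bounded_clinear f \<Longrightarrow> bounded_linear f"
  by (simp add: bounded_clinear_iff)

lemma bounded_linear_scaleC_right: "bounded_linear (\<lambda>x::'a::complex_normed_vector. c *\<^sub>C x)"
  by (rule bounded_linear_intro[where K = "cmod c"])
    (auto simp: scaleC_add_right norm_scaleC scaleC_scaleC mult.commute simp flip: scaleC_of_real)

lemma bounded_clinear_compose:
  assumes "bounded_clinear f" "bounded_clinear g"
  shows "bounded_clinear (\<lambda>x. f (g x))"
  using assms bounded_linear_compose[of f g] by (auto simp: bounded_clinear_iff)


section \<open>The dual of a complex normed space\<close>

typedef (overloaded) 'a dual = "{f :: 'a::complex_normed_vector \<Rightarrow> complex. bounded_clinear f}"
  morphisms dual_apply Dual
  by (rule exI[of _ "\<lambda>_. 0"]) (simp add: bounded_clinear_iff scaleC_complex_def)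

setup_lifting type_definition_dual

instantiation dual :: (complex_normed_vector) complex_normed_vector
begin

lift_definition norm_dual :: "'a dual \<Rightarrow> real" is onorm .

lift_definition zero_dual :: "'a dual" is "\<lambda>_. 0"
  by (simp add: bounded_clinear_iff scaleC_complex_def)

lift_definition plus_dual :: "'a dual \<Rightarrow> 'a dual \<Rightarrow> 'a dual" is "\<lambda>f g x. f x + g x"
  by (auto simp: bounded_clinear_iff bounded_linear_add scaleC_complex_def algebra_simps)

lift_definition minus_dual :: "'a dual \<Rightarrow> 'a dual \<Rightarrow> 'a dual" is "\<lambda>f g x. f x - g x"
  by (auto simp: bounded_clinear_iff bounded_linear_sub scaleC_complex_def algebra_simps)

lift_definition uminus_dual :: "'a dual \<Rightarrow> 'a dual" is "\<lambda>f x. - f x"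
  by (auto simp: bounded_clinear_iff bounded_linear_minus scaleC_complex_def algebra_simps)

lift_definition scaleC_dual :: "complex \<Rightarrow> 'a dual \<Rightarrow> 'a dual" is "\<lambda>c f x. c * f x"
  by (auto simp: bounded_clinear_iff bounded_linear_const_mult scaleC_complex_def algebra_simps)

lift_definition scaleR_dual :: "real \<Rightarrow> 'a dual \<Rightarrow> 'a dual" is "\<lambda>r f x. complex_of_real r * f x"
  by (auto simp: bounded_clinear_iff scaleC_complex_def mult.left_commute
      intro!: bounded_linear_const_mult)

definition dist_dual :: "'a dual \<Rightarrow> 'a dual \<Rightarrow> real"
  where "dist_dual f g = norm (f - g)"

definition sgn_dual :: "'a dual \<Rightarrow> 'a dual"
  where "sgn_dual f = inverse (norm f) *\<^sub>R f"

definition uniformity_dual :: "('a dual \<times> 'a dual) filter"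
  where "uniformity_dual = (INF e\<in>{0 <..}. principal {(x, y). dist x y < e})"

definition open_dual :: "'a dual set \<Rightarrow> bool"
  where "open_dual U = (\<forall>x\<in>U. \<forall>\<^sub>F (x', y) in uniformity. x' = x \<longrightarrow> y \<in> U)"

instance
proof
  fix f g :: "'a dual" and c :: complex and r :: real
  show "(norm f = 0) = (f = 0)"
    by transfer (auto simp: fun_eq_iff bounded_clinear_iff onorm_eq_0)
  show "norm (f + g) \<le> norm f + norm g"
    by transfer (simp add: onorm_triangle bounded_clinear_iff)
  show *: "norm (c *\<^sub>C f) = cmod c * norm f" for c and f :: "'a dual"
  proof (cases "c = 0")
    case True
    then show ?thesis by transfer (simp add: onorm_zero)
  next
    case False
    show ?thesis
    proof transfer
      fix c and f :: "'a \<Rightarrow> complex"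
      assume "bounded_clinear f"
      then have f: "bounded_linear f" by (simp add: bounded_clinear_iff)
      have le: "onorm (\<lambda>x. c * g x) \<le> cmod c * onorm g" if "bounded_linear g" for c and g :: "'a \<Rightarrow> complex"
        by (intro onorm_bound)
          (auto simp: norm_mult mult.assoc
            intro!: mult_left_mono mult_nonneg_nonneg onorm onorm_pos_le that)
      show "onorm (\<lambda>x. c * f x) = cmod c * onorm f"
      proof (cases "c = 0")
        case True
        then show ?thesis by (simp add: onorm_zero)
      next
        case False
        have "onorm f \<le> cmod (inverse c) * onorm (\<lambda>x. c * f x)"
          using le[OF bounded_linear_const_mult[OF f, of c], of "inverse c"] False
          by (simp add: mult.assoc[symmetric])
        then have "cmod c * onorm f \<le> onorm (\<lambda>x. c * f x)"
          using False by (simp add: norm_divide field_simps)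
        with le[OF f, of c] show ?thesis by simp
      qed
    qed
  qed
  have "r *\<^sub>R f = complex_of_real r *\<^sub>C f"
    by transfer simp
  then show "norm (r *\<^sub>R f) = \<bar>r\<bar> * norm f"
    using * by simp
qed (transfer; auto simp: dist_dual_def sgn_dual_def uniformity_dual_def open_dual_def algebra_simps)+

end

definition dual_map :: "('a::complex_normed_vector \<Rightarrow> 'b::complex_normed_vector) \<Rightarrow> 'b dual \<Rightarrow> 'a dual"
  where "dual_map T f = Dual (\<lambda>x. dual_apply f (T x))"

lemma bounded_clinear_dual_apply: "bounded_clinear (dual_apply f)"
  using dual_apply by auto

lemma dual_map_apply:
  assumes "bounded_clinear T"
  shows "dual_apply (dual_map T f) x = dual_apply f (T x)"
  using bounded_clinear_compose[OF bounded_clinear_dual_apply assms]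
  by (simp add: dual_map_def Dual_inverse)

text \<open>
  The actions on the dual of a bimodule: \<open>lact a x\<close> and \<open>ract x a\<close> are the left and right
  actions on the bimodule itself.
\<close>

definition dual_lact :: "('x \<Rightarrow> 'a \<Rightarrow> 'x) \<Rightarrow> 'a \<Rightarrow> 'x::complex_normed_vector dual \<Rightarrow> 'x dual"
  where "dual_lact ract a l = Dual (\<lambda>x. dual_apply l (ract x a))"

definition dual_ract :: "('a \<Rightarrow> 'x \<Rightarrow> 'x) \<Rightarrow> 'x::complex_normed_vector dual \<Rightarrow> 'a \<Rightarrow> 'x dual"
  where "dual_ract lact l a = Dual (\<lambda>x. dual_apply l (lact a x))"

lemma dual_lact_apply:
  assumes "bounded_clinear (\<lambda>x. ract x a)"
  shows "dual_apply (dual_lact ract a l) x = dual_apply l (ract x a)"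
  using bounded_clinear_compose[OF bounded_clinear_dual_apply assms]
  by (simp add: dual_lact_def Dual_inverse)

lemma dual_ract_apply:
  assumes "bounded_clinear (lact a)"
  shows "dual_apply (dual_ract lact l a) x = dual_apply l (lact a x)"
  using bounded_clinear_compose[OF bounded_clinear_dual_apply assms]
  by (simp add: dual_ract_def Dual_inverse)


section \<open>The algebraic tensor product\<close>

text \<open>
  A list \<open>[(a\<^sub>1, b\<^sub>1), \<dots>, (a\<^sub>n, b\<^sub>n)]\<close> stands for the formal sum \<open>\<Sum>i. a\<^sub>i \<otimes> b\<^sub>i\<close>; the tensor product
  consists of the formal sums modulo the congruence generated by bilinearity.  Multiples and
  negatives need no formal symbols because \<open>c (a \<otimes> b) = (c a) \<otimes> b\<close>.
\<close>

inductive tensor_eq :: "('a::complex_vector \<times> 'b::complex_vector) list \<Rightarrow> ('a \<times> 'b) list \<Rightarrow> bool" where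
  refl: "tensor_eq xs xs"
| sym: "tensor_eq xs ys \<Longrightarrow> tensor_eq ys xs"
| trans: "tensor_eq xs ys \<Longrightarrow> tensor_eq ys zs \<Longrightarrow> tensor_eq xs zs"
| append: "tensor_eq xs ys \<Longrightarrow> tensor_eq us vs \<Longrightarrow> tensor_eq (xs @ us) (ys @ vs)"
| comm: "tensor_eq (xs @ ys) (ys @ xs)"
| zero: "tensor_eq [(0, b)] []"
| add_left: "tensor_eq [(a + a', b)] [(a, b), (a', b)]"
| add_right: "tensor_eq [(a, b + b')] [(a, b), (a, b')]"
| scale: "tensor_eq [(c *\<^sub>C a, b)] [(a, c *\<^sub>C b)]"

quotient_type (overloaded) ('a, 'b) atensor =
    "('a::complex_vector \<times> 'b::complex_vector) list" / tensor_eq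
  by (auto intro!: equivpI reflpI sympI transpI intro: tensor_eq.intros)

abbreviation tensor_list_scale ::
    "complex \<Rightarrow> ('a::complex_vector \<times> 'b::complex_vector) list \<Rightarrow> ('a \<times> 'b) list"
  where "tensor_list_scale c \<equiv> map (\<lambda>(a, b). (c *\<^sub>C a, b))"

lemma tensor_eq_scale:
  "tensor_eq xs ys \<Longrightarrow> tensor_eq (tensor_list_scale c xs) (tensor_list_scale c ys)"
proof (induction rule: tensor_eq.induct)
  case (zero b)
  have "c *\<^sub>C 0 = (0 :: 'a)"
    using scaleC_scaleC[of c 0 "0::'a"] by simp
  then show ?case by (simp add: tensor_eq.zero)
next
  case (scale d a b)
  show ?case
    using tensor_eq.scale[of d "c *\<^sub>C a" b] by (simp add: scaleC_scaleC mult.commute)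
qed (auto simp: scaleC_add_right intro: tensor_eq.intros)

lemma tensor_eq_scale_add:
  "tensor_eq (tensor_list_scale (c + d) xs) (tensor_list_scale c xs @ tensor_list_scale d xs)"
proof (induction xs)
  case Nil
  show ?case by (simp add: tensor_eq.refl)
next
  case (Cons x xs)
  obtain a b where x: "x = (a, b)" by (cases x)
  let ?s = "\<lambda>e. [(e *\<^sub>C a, b)]"
  let ?c = "tensor_list_scale c xs" and ?d = "tensor_list_scale d xs"
  have "tensor_eq (?s (c + d) @ tensor_list_scale (c + d) xs) ((?s c @ ?s d) @ (?c @ ?d))"
    using Cons.IH by (intro tensor_eq.append) (auto simp: scaleC_add_left intro: tensor_eq.add_left)
  also have "(?s c @ ?s d) @ (?c @ ?d) = ?s c @ ((?s d @ ?c) @ ?d)"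
    by simp
  finally have 1: "tensor_eq (?s (c + d) @ tensor_list_scale (c + d) xs) (?s c @ ((?s d @ ?c) @ ?d))" .
  have 2: "tensor_eq (?s c @ ((?s d @ ?c) @ ?d)) (?s c @ ((?c @ ?s d) @ ?d))"
    by (intro tensor_eq.append tensor_eq.refl tensor_eq.comm)
  show ?case
    using tensor_eq.trans[OF 1 2] by (simp add: x)
qed

lemma tensor_eq_zero: "tensor_eq (tensor_list_scale 0 xs) []"
proof (induction xs)
  case (Cons x xs)
  show ?case
    using tensor_eq.append[OF tensor_eq.zero[of "snd x"] Cons.IH]
    by (simp add: case_prod_unfold)
qed (simp add: tensor_eq.refl)

lemma tensor_list_scale_one: "tensor_list_scale 1 xs = xs"
  by (simp add: scaleC_one case_prod_unfold)

instantiation atensor :: (complex_vector, complex_vector) complex_vector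
begin

lift_definition zero_atensor :: "('a, 'b) atensor" is "[]" .

lift_definition plus_atensor :: "('a, 'b) atensor \<Rightarrow> ('a, 'b) atensor \<Rightarrow> ('a, 'b) atensor" is "(@)"
  by (rule tensor_eq.append)

lift_definition scaleC_atensor :: "complex \<Rightarrow> ('a, 'b) atensor \<Rightarrow> ('a, 'b) atensor"
  is tensor_list_scale
  by (rule tensor_eq_scale)

definition scaleR_atensor :: "real \<Rightarrow> ('a, 'b) atensor \<Rightarrow> ('a, 'b) atensor"
  where "scaleR_atensor r t = complex_of_real r *\<^sub>C t"

definition uminus_atensor :: "('a, 'b) atensor \<Rightarrow> ('a, 'b) atensor"
  where "uminus_atensor t = (- 1) *\<^sub>C t"

definition minus_atensor :: "('a, 'b) atensor \<Rightarrow> ('a, 'b) atensor \<Rightarrow> ('a, 'b) atensor"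
  where "minus_atensor t u = t + - u"

instance
proof
  fix t u v :: "('a, 'b) atensor" and c d :: complex and r s :: real
  show "t + u + v = t + (u + v)"
    by transfer (simp add: tensor_eq.refl)
  show "t + u = u + t"
    by transfer (rule tensor_eq.comm)
  show zero: "0 + t = t" for t :: "('a, 'b) atensor"
    by transfer (simp add: tensor_eq.refl)
  show add: "(c + d) *\<^sub>C t = c *\<^sub>C t + d *\<^sub>C t" for c d and t :: "('a, 'b) atensor"
    by transfer (rule tensor_eq_scale_add)
  show one: "1 *\<^sub>C t = t" for t :: "('a, 'b) atensor"
    by transfer (simp only: tensor_list_scale_one tensor_eq.refl)
  have "0 *\<^sub>C t = 0" for t :: "('a, 'b) atensor"
    by transfer (rule tensor_eq_zero)
  then show "- t + t = 0"
    using add[of "-1" 1 t] by (simp add: uminus_atensor_def one)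
  show "t - u = t + - u"
    by (fact minus_atensor_def)
  show addr: "c *\<^sub>C (t + u) = c *\<^sub>C t + c *\<^sub>C u" for c
    by transfer (simp add: tensor_eq.refl)
  show scale: "c *\<^sub>C d *\<^sub>C t = (c * d) *\<^sub>C t" for c d
    by transfer (simp add: tensor_eq.refl scaleC_scaleC case_prod_unfold comp_def)
  show "complex_of_real r *\<^sub>C t = r *\<^sub>R t"
    by (fact scaleR_atensor_def[symmetric])
  show "r *\<^sub>R (t + u) = r *\<^sub>R t + r *\<^sub>R u"
    by (simp add: scaleR_atensor_def addr)
  show "(r + s) *\<^sub>R t = r *\<^sub>R t + s *\<^sub>R t"
    by (simp add: scaleR_atensor_def add)
  show "r *\<^sub>R s *\<^sub>R t = (r * s) *\<^sub>R t"
    by (simp add: scaleR_atensor_def scale)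
  show "1 *\<^sub>R t = t"
    by (simp add: scaleR_atensor_def one)
qed

end

lift_definition atensor :: "'a::complex_vector \<Rightarrow> 'b::complex_vector \<Rightarrow> ('a, 'b) atensor"
  is "\<lambda>a b. [(a, b)]" .

lemma abs_atensor_eq_sum: "abs_atensor xs = (\<Sum>(a, b)\<leftarrow>xs. atensor a b)"
proof (induction xs)
  case Nil
  show ?case by (simp add: zero_atensor.abs_eq)
next
  case (Cons x xs)
  have "abs_atensor (x # xs) = abs_atensor [x] + abs_atensor xs"
    by (simp add: plus_atensor.abs_eq)
  with Cons.IH show ?case
    by (simp add: atensor.abs_eq case_prod_unfold)
qed

lemma atensor_representation: "\<exists>xs. t = (\<Sum>(a, b)\<leftarrow>xs. atensor a b)"
  by (metis abs_atensor_eq_sum Quotient_abs_rep[OF Quotient_atensor])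

lemma atensor_induct [case_names zero atensor add]:
  assumes "P 0" "\<And>a b. P (atensor a b)" "\<And>t u. P t \<Longrightarrow> P u \<Longrightarrow> P (t + u)"
  shows "P t"
proof -
  obtain xs where "t = (\<Sum>(a, b)\<leftarrow>xs. atensor a b)"
    using atensor_representation by blast
  moreover have "P (\<Sum>(a, b)\<leftarrow>xs. atensor a b)"
    by (induction xs) (auto intro: assms)
  ultimately show ?thesis by simp
qed

lemma atensor_scaleC: "c *\<^sub>C atensor a b = atensor (c *\<^sub>C a) b"
  by transfer (simp add: tensor_eq.refl)

lemma atensor_scaleC_right: "c *\<^sub>C atensor a b = atensor a (c *\<^sub>C b)"
  by transfer (simp add: tensor_eq.scale)

lemma atensor_add_left: "atensor (a + a') b = atensor a b + atensor a' b"
  by transfer (simp add: tensor_eq.add_left)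

lemma atensor_add_right: "atensor a (b + b') = atensor a b + atensor a b'"
  by transfer (simp add: tensor_eq.add_right)

context
  fixes B :: "'a::complex_vector \<Rightarrow> 'b::complex_vector \<Rightarrow> 'c::complex_vector"
  assumes B_left: "\<And>b. clinear (\<lambda>a. B a b)" and B_right: "\<And>a. clinear (B a)"
begin

lemma tensor_eq_bilinear:
  "tensor_eq xs ys \<Longrightarrow> (\<Sum>(a, b)\<leftarrow>xs. B a b) = (\<Sum>(a, b)\<leftarrow>ys. B a b)"
proof (induction rule: tensor_eq.induct)
  case (zero b)
  show ?case using clinear_zero[OF B_left] by simp
qed (auto simp: clinear_add[OF B_left] clinear_add[OF B_right]
      clinear_scaleC[OF B_left] clinear_scaleC[OF B_right])

lemma atensor_universal: "\<exists>T. clinear T \<and> (\<forall>a b. T (atensor a b) = B a b)"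
proof (intro exI conjI allI)
  define T where "T t = (\<Sum>(a, b)\<leftarrow>rep_atensor t. B a b)" for t
  have T: "T (abs_atensor xs) = (\<Sum>(a, b)\<leftarrow>xs. B a b)" for xs
  proof -
    have "tensor_eq (rep_atensor (abs_atensor xs)) xs"
      using Quotient_rep_abs[OF Quotient_atensor] tensor_eq.refl by blast
    then show ?thesis
      unfolding T_def by (rule tensor_eq_bilinear)
  qed
  show TB: "T (atensor a b) = B a b" for a b
    by (simp add: atensor.abs_eq T)
  have abs: "\<exists>xs. t = abs_atensor xs" for t :: "('a, 'b) atensor"
    by (metis Quotient_abs_rep[OF Quotient_atensor])
  have add: "T (t + u) = T t + T u" for t u
  proof -
    obtain xs ys where "t = abs_atensor xs" "u = abs_atensor ys"
      using abs by metis
    then show ?thesis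
      by (simp add: plus_atensor.abs_eq T)
  qed
  have scale: "T (c *\<^sub>C t) = c *\<^sub>C T t" for c t
  proof (induction t rule: atensor_induct)
    case zero
    have "c *\<^sub>C (0::'c) = 0" "c *\<^sub>C (0::('a, 'b) atensor) = 0"
      using scaleC_add_right[of c "0::'c" 0] scaleC_add_right[of c "0::('a, 'b) atensor" 0] by simp_all
    then show ?case by (simp add: zero_atensor.abs_eq T)
  next
    case (atensor a b)
    show ?case
      by (simp add: atensor_scaleC TB clinear_scaleC[OF B_left])
  qed (simp add: scaleC_add_right add)
  show "clinear T"
    by (simp add: clinear_def add scale)
qed

end


lifting_forget atensor.lifting


section \<open>The projective tensor product\<close>

definition projective_norm :: "('a::complex_normed_vector, 'b::complex_normed_vector) atensor \<Rightarrow> real"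
  where "projective_norm t = Inf {(\<Sum>(a, b)\<leftarrow>xs. norm a * norm b) |xs. t = (\<Sum>(a, b)\<leftarrow>xs. atensor a b)}"

lemma projective_norm_le:
  assumes "t = (\<Sum>(a, b)\<leftarrow>xs. atensor a b)"
  shows "projective_norm t \<le> (\<Sum>(a, b)\<leftarrow>xs. norm a * norm b)"
  unfolding projective_norm_def using assms
  by (intro cInf_lower bdd_belowI[of _ 0]) (auto intro!: sum_list_nonneg)

lemma projective_norm_greatest:
  assumes "\<And>xs. t = (\<Sum>(a, b)\<leftarrow>xs. atensor a b) \<Longrightarrow> C \<le> (\<Sum>(a, b)\<leftarrow>xs. norm a * norm b)"
  shows "C \<le> projective_norm t"
  unfolding projective_norm_def using atensor_representation[of t] assms
  by (intro cInf_greatest) auto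

lemma projective_norm_approx:
  assumes "projective_norm t < C"
  obtains xs where "t = (\<Sum>(a, b)\<leftarrow>xs. atensor a b)" "(\<Sum>(a, b)\<leftarrow>xs. norm a * norm b) < C"
  using projective_norm_greatest[of t C] assms by (meson not_less)

lemma projective_norm_nonneg: "0 \<le> projective_norm t"
  by (rule projective_norm_greatest) (auto intro!: sum_list_nonneg)

lemma projective_norm_zero: "projective_norm 0 = 0"
  using projective_norm_le[of 0 "[]"] by (intro antisym projective_norm_nonneg) simp

lemma projective_norm_atensor: "projective_norm (atensor a b) \<le> norm a * norm b"
  using projective_norm_le[of "atensor a b" "[(a, b)]"] by simp

lemma projective_norm_triangle: "projective_norm (t + u) \<le> projective_norm t + projective_norm u"
proof (rule field_le_epsilon)
  fix e :: real
  assume "0 < e"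
  obtain xs where xs: "t = (\<Sum>(a, b)\<leftarrow>xs. atensor a b)"
      "(\<Sum>(a, b)\<leftarrow>xs. norm a * norm b) < projective_norm t + e / 2"
    by (rule projective_norm_approx[of t "projective_norm t + e / 2"]) (use \<open>0 < e\<close> in auto)
  obtain ys where ys: "u = (\<Sum>(a, b)\<leftarrow>ys. atensor a b)"
      "(\<Sum>(a, b)\<leftarrow>ys. norm a * norm b) < projective_norm u + e / 2"
    by (rule projective_norm_approx[of u "projective_norm u + e / 2"]) (use \<open>0 < e\<close> in auto)
  show "projective_norm (t + u) \<le> projective_norm t + projective_norm u + e"
    using projective_norm_le[of "t + u" "xs @ ys"] xs ys by simp
qed

lemma projective_norm_scaleC: "projective_norm (c *\<^sub>C t) = cmod c * projective_norm t"
proof -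
  have le: "projective_norm (c *\<^sub>C t) \<le> cmod c * projective_norm t"
    if "c \<noteq> 0" for c and t :: "('a::complex_normed_vector, 'b::complex_normed_vector) atensor"
  proof -
    have "projective_norm (c *\<^sub>C t) / cmod c \<le> projective_norm t"
    proof (rule projective_norm_greatest)
      fix xs
      assume t: "t = (\<Sum>(a, b)\<leftarrow>xs. atensor a b)"
      let ?ys = "map (\<lambda>(a, b). (c *\<^sub>C a, b)) xs"
      have zero: "c *\<^sub>C (0::('a, 'b) atensor) = 0"
        using scaleC_add_right[of c "0::('a, 'b) atensor" 0] by simp
      have "c *\<^sub>C t = (\<Sum>(a, b)\<leftarrow>?ys. atensor a b)"
        unfolding t by (induction xs) (auto simp: zero scaleC_add_right atensor_scaleC)
      from projective_norm_le[OF this]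
      have "projective_norm (c *\<^sub>C t) \<le> (\<Sum>(a, b)\<leftarrow>?ys. norm a * norm b)" .
      also have "\<dots> = cmod c * (\<Sum>(a, b)\<leftarrow>xs. norm a * norm b)"
        by (induction xs) (auto simp: norm_scaleC algebra_simps)
      finally show "projective_norm (c *\<^sub>C t) / cmod c \<le> (\<Sum>(a, b)\<leftarrow>xs. norm a * norm b)"
        using \<open>c \<noteq> 0\<close> by (simp add: field_simps)
    qed
    then show ?thesis
      using \<open>c \<noteq> 0\<close> by (simp add: field_simps)
  qed
  show ?thesis
  proof (cases "c = 0")
    case True
    then show ?thesis by (simp add: projective_norm_zero)
  next
    case False
    have "projective_norm (inverse c *\<^sub>C c *\<^sub>C t) \<le> cmod (inverse c) * projective_norm (c *\<^sub>C t)"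
      using False by (intro le) simp
    then have "cmod c * projective_norm t \<le> projective_norm (c *\<^sub>C t)"
      using False by (simp add: scaleC_scaleC scaleC_one norm_divide field_simps)
    with le[OF False, of t] show ?thesis by simp
  qed
qed

lemma projective_norm_minus: "projective_norm (- t) = projective_norm t"
  using projective_norm_scaleC[of "-1" t] by (simp add: scaleC_minus_one)

lemma projective_norm_diff_commute: "projective_norm (t - u) = projective_norm (u - t)"
  using projective_norm_minus[of "t - u"] by simp

lemma projective_norm_triangle_diff:
  "projective_norm (t - v) \<le> projective_norm (t - u) + projective_norm (u - v)"
  using projective_norm_triangle[of "t - u" "u - v"] by simp

lemma projective_norm_abs_diff:
  "\<bar>projective_norm t - projective_norm u\<bar> \<le> projective_norm (t - u)"
  using projective_norm_triangle[of "t - u" u] projective_norm_triangle[of "u - t" t]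
    projective_norm_diff_commute[of t u] by simp

text \<open>The completion with respect to the projective norm: Cauchy sequences modulo null sequences.\<close>

definition pcauchy :: "(nat \<Rightarrow> ('a::complex_normed_vector, 'b::complex_normed_vector) atensor) \<Rightarrow> bool"
  where "pcauchy X \<longleftrightarrow> (\<forall>e>0. \<exists>N. \<forall>m\<ge>N. \<forall>n\<ge>N. projective_norm (X m - X n) < e)"

definition pequiv :: "(nat \<Rightarrow> ('a::complex_normed_vector, 'b::complex_normed_vector) atensor)
    \<Rightarrow> (nat \<Rightarrow> ('a, 'b) atensor) \<Rightarrow> bool"
  where "pequiv X Y \<longleftrightarrow> pcauchy X \<and> pcauchy Y \<and> (\<lambda>n. projective_norm (X n - Y n)) \<longlonglongrightarrow> 0"

lemma pcauchy_const: "pcauchy (\<lambda>_. t)"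
  by (auto simp: pcauchy_def projective_norm_zero)

lemma pequiv_refl: "pcauchy X \<Longrightarrow> pequiv X X"
  by (simp add: pequiv_def projective_norm_zero)

lemma null_le:
  fixes f g :: "nat \<Rightarrow> real"
  assumes "g \<longlonglongrightarrow> 0" "\<And>n. 0 \<le> f n" "\<And>n. f n \<le> g n"
  shows "f \<longlonglongrightarrow> 0"
  by (rule tendsto_sandwich[OF _ _ tendsto_const assms(1)]) (use assms in auto)

quotient_type (overloaded) ('a, 'b) ptensor =
    "nat \<Rightarrow> ('a::complex_normed_vector, 'b::complex_normed_vector) atensor" / partial: pequiv
proof (rule part_equivpI)
  show "\<exists>X::nat \<Rightarrow> ('a, 'b) atensor. pequiv X X"
    using pequiv_refl[OF pcauchy_const] by blast
  show "symp (pequiv :: (nat \<Rightarrow> ('a, 'b) atensor) \<Rightarrow> _)"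
    by (rule sympI) (simp add: pequiv_def projective_norm_diff_commute)
  show "transp (pequiv :: (nat \<Rightarrow> ('a, 'b) atensor) \<Rightarrow> _)"
  proof (rule transpI)
    fix X Y Z :: "nat \<Rightarrow> ('a, 'b) atensor"
    assume XY: "pequiv X Y" and YZ: "pequiv Y Z"
    have "(\<lambda>n. projective_norm (X n - Y n) + projective_norm (Y n - Z n)) \<longlonglongrightarrow> 0"
      using XY YZ tendsto_add[of _ "0::real" _ _ 0] by (force simp: pequiv_def)
    then have "(\<lambda>n. projective_norm (X n - Z n)) \<longlonglongrightarrow> 0"
      by (rule null_le) (auto simp: projective_norm_nonneg projective_norm_triangle_diff)
    then show "pequiv X Z"
      using XY YZ by (simp add: pequiv_def)
  qed
qed

lemma pcauchy_norm_convergent: "pcauchy X \<Longrightarrow> convergent (\<lambda>n. projective_norm (X n))"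
  unfolding Cauchy_convergent_iff[symmetric] Cauchy_def pcauchy_def dist_real_def
  by (meson projective_norm_abs_diff order_le_less_trans)

lemma pcauchy_add:
  assumes "pcauchy X" "pcauchy Y"
  shows "pcauchy (\<lambda>n. X n + Y n)"
  unfolding pcauchy_def
proof (intro allI impI)
  fix e :: real
  assume "0 < e"
  then have "0 < e / 2" by simp
  obtain M where M: "\<And>m n. m \<ge> M \<Longrightarrow> n \<ge> M \<Longrightarrow> projective_norm (X m - X n) < e / 2"
    using assms(1) \<open>0 < e / 2\<close> unfolding pcauchy_def by blast
  obtain N where N: "\<And>m n. m \<ge> N \<Longrightarrow> n \<ge> N \<Longrightarrow> projective_norm (Y m - Y n) < e / 2"
    using assms(2) \<open>0 < e / 2\<close> unfolding pcauchy_def by blast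
  have "projective_norm (X m + Y m - (X n + Y n)) < e" if "m \<ge> max M N" "n \<ge> max M N" for m n
    using M[of m n] N[of m n] projective_norm_triangle[of "X m - X n" "Y m - Y n"] that
    by (simp add: algebra_simps)
  then show "\<exists>N. \<forall>m\<ge>N. \<forall>n\<ge>N. projective_norm (X m + Y m - (X n + Y n)) < e"
    by blast
qed

lemma scaleC_diff_right: "c *\<^sub>C (x - y) = c *\<^sub>C x - c *\<^sub>C (y :: 'a::complex_vector)"
  using scaleC_add_right[of c "x - y" y] by simp

lemma pcauchy_scaleC:
  assumes "pcauchy X"
  shows "pcauchy (\<lambda>n. c *\<^sub>C X n)"
  unfolding pcauchy_def
proof (intro allI impI)
  fix e :: real
  assume "0 < e"
  have pos: "0 < cmod c + 1"
    by (intro add_nonneg_pos) auto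
  with \<open>0 < e\<close> have "0 < e / (cmod c + 1)"
    by (rule divide_pos_pos)
  then obtain N where N: "\<And>m n. m \<ge> N \<Longrightarrow> n \<ge> N \<Longrightarrow> projective_norm (X m - X n) < e / (cmod c + 1)"
    using assms unfolding pcauchy_def by blast
  have "projective_norm (c *\<^sub>C X m - c *\<^sub>C X n) < e" if "m \<ge> N" "n \<ge> N" for m n
  proof -
    have "projective_norm (c *\<^sub>C X m - c *\<^sub>C X n) = cmod c * projective_norm (X m - X n)"
      by (simp add: projective_norm_scaleC flip: scaleC_diff_right)
    also have "\<dots> \<le> (cmod c + 1) * projective_norm (X m - X n)"
      by (intro mult_right_mono) (auto simp: projective_norm_nonneg)
    also have "\<dots> < e"
      using N[OF that] pos by (simp only: pos_less_divide_eq mult.commute)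
    finally show ?thesis .
  qed
  then show "\<exists>N. \<forall>m\<ge>N. \<forall>n\<ge>N. projective_norm (c *\<^sub>C X m - c *\<^sub>C X n) < e"
    by blast
qed

lemma pequiv_add:
  assumes "pequiv X X'" "pequiv Y Y'"
  shows "pequiv (\<lambda>n. X n + Y n) (\<lambda>n. X' n + Y' n)"
proof -
  have "(\<lambda>n. projective_norm (X n - X' n) + projective_norm (Y n - Y' n)) \<longlonglongrightarrow> 0"
    using assms tendsto_add[of _ "0::real" _ _ 0] by (force simp: pequiv_def)
  then have "(\<lambda>n. projective_norm (X n + Y n - (X' n + Y' n))) \<longlonglongrightarrow> 0"
  proof (rule null_le)
    show "projective_norm (X n + Y n - (X' n + Y' n))
        \<le> projective_norm (X n - X' n) + projective_norm (Y n - Y' n)" for n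
      using projective_norm_triangle[of "X n - X' n" "Y n - Y' n"] by (simp add: algebra_simps)
  qed (simp add: projective_norm_nonneg)
  then show ?thesis
    using assms by (simp add: pequiv_def pcauchy_add)
qed

lemma pequiv_scaleC:
  assumes "pequiv X X'"
  shows "pequiv (\<lambda>n. c *\<^sub>C X n) (\<lambda>n. c *\<^sub>C X' n)"
  using assms tendsto_mult_right_zero[of "\<lambda>n. projective_norm (X n - X' n)" sequentially "cmod c"]
  by (simp add: pequiv_def pcauchy_scaleC projective_norm_scaleC flip: scaleC_diff_right)

instantiation ptensor :: (complex_normed_vector, complex_normed_vector) complex_normed_vector
begin

lift_definition zero_ptensor :: "('a, 'b) ptensor" is "\<lambda>_. 0"
  by (intro pequiv_refl pcauchy_const)

lift_definition plus_ptensor :: "('a, 'b) ptensor \<Rightarrow> ('a, 'b) ptensor \<Rightarrow> ('a, 'b) ptensor"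
  is "\<lambda>X Y n. X n + Y n"
  by (rule pequiv_add)

lift_definition scaleC_ptensor :: "complex \<Rightarrow> ('a, 'b) ptensor \<Rightarrow> ('a, 'b) ptensor"
  is "\<lambda>c X n. c *\<^sub>C X n"
  by (rule pequiv_scaleC)

lift_definition norm_ptensor :: "('a, 'b) ptensor \<Rightarrow> real"
  is "\<lambda>X. lim (\<lambda>n. projective_norm (X n))"
proof -
  fix X Y :: "nat \<Rightarrow> ('a, 'b) atensor"
  assume XY: "pequiv X Y"
  then have "(\<lambda>n. projective_norm (Y n)) \<longlonglongrightarrow> lim (\<lambda>n. projective_norm (Y n))"
    using pcauchy_norm_convergent by (auto simp: pequiv_def convergent_LIMSEQ_iff)
  moreover have "(\<lambda>n. projective_norm (X n) - projective_norm (Y n)) \<longlonglongrightarrow> 0"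
    by (rule tendsto_rabs_zero_cancel, rule null_le[of "\<lambda>n. projective_norm (X n - Y n)"])
      (use XY in \<open>auto simp: pequiv_def projective_norm_abs_diff\<close>)
  ultimately have "(\<lambda>n. projective_norm (X n)) \<longlonglongrightarrow> lim (\<lambda>n. projective_norm (Y n))"
    using tendsto_add by fastforce
  then show "lim (\<lambda>n. projective_norm (X n)) = lim (\<lambda>n. projective_norm (Y n))"
    by (rule limI)
qed

definition scaleR_ptensor :: "real \<Rightarrow> ('a, 'b) ptensor \<Rightarrow> ('a, 'b) ptensor"
  where "scaleR_ptensor r t = complex_of_real r *\<^sub>C t"

definition uminus_ptensor :: "('a, 'b) ptensor \<Rightarrow> ('a, 'b) ptensor"
  where "uminus_ptensor t = (- 1) *\<^sub>C t"

definition minus_ptensor :: "('a, 'b) ptensor \<Rightarrow> ('a, 'b) ptensor \<Rightarrow> ('a, 'b) ptensor"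
  where "minus_ptensor t u = t + - u"

definition dist_ptensor :: "('a, 'b) ptensor \<Rightarrow> ('a, 'b) ptensor \<Rightarrow> real"
  where "dist_ptensor t u = norm (t - u)"

definition sgn_ptensor :: "('a, 'b) ptensor \<Rightarrow> ('a, 'b) ptensor"
  where "sgn_ptensor t = inverse (norm t) *\<^sub>R t"

definition uniformity_ptensor :: "(('a, 'b) ptensor \<times> ('a, 'b) ptensor) filter"
  where "uniformity_ptensor = (INF e\<in>{0 <..}. principal {(x, y). dist x y < e})"

definition open_ptensor :: "('a, 'b) ptensor set \<Rightarrow> bool"
  where "open_ptensor U = (\<forall>x\<in>U. \<forall>\<^sub>F (x', y) in uniformity. x' = x \<longrightarrow> y \<in> U)"

instance
proof
  fix t u v :: "('a, 'b) ptensor" and c d :: complex and r s :: real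
  have lim: "(\<lambda>n. projective_norm (X n)) \<longlonglongrightarrow> lim (\<lambda>n. projective_norm (X n))"
    if "pequiv X X" for X :: "nat \<Rightarrow> ('a, 'b) atensor"
    using that pcauchy_norm_convergent by (auto simp: pequiv_def convergent_LIMSEQ_iff)
  note refl = pequiv_add pequiv_scaleC pequiv_refl pcauchy_const
  show "t + u + v = t + (u + v)"
    by transfer (simp add: add.assoc refl)
  show "t + u = u + t"
    by transfer (subst add.commute, simp add: refl)
  show zero: "0 + t = t" for t :: "('a, 'b) ptensor"
    by transfer simp
  show add: "(c + d) *\<^sub>C t = c *\<^sub>C t + d *\<^sub>C t" for c d and t :: "('a, 'b) ptensor"
    by transfer (simp add: scaleC_add_left refl)
  show one: "1 *\<^sub>C t = t" for t :: "('a, 'b) ptensor"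
    by transfer (simp add: scaleC_one)
  have "0 *\<^sub>C t = 0" for t :: "('a, 'b) ptensor"
    by transfer (simp add: refl)
  then show "- t + t = 0"
    using add[of "-1" 1 t] by (simp add: uminus_ptensor_def one)
  show "t - u = t + - u"
    by (fact minus_ptensor_def)
  show addr: "c *\<^sub>C (t + u) = c *\<^sub>C t + c *\<^sub>C u" for c
    by transfer (simp add: scaleC_add_right refl)
  show scale: "c *\<^sub>C d *\<^sub>C t = (c * d) *\<^sub>C t" for c d
    by transfer (simp add: scaleC_scaleC refl)
  show "complex_of_real r *\<^sub>C t = r *\<^sub>R t"
    by (fact scaleR_ptensor_def[symmetric])
  show "r *\<^sub>R (t + u) = r *\<^sub>R t + r *\<^sub>R u"
    by (simp add: scaleR_ptensor_def addr)
  show "(r + s) *\<^sub>R t = r *\<^sub>R t + s *\<^sub>R t"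
    by (simp add: scaleR_ptensor_def add)
  show "r *\<^sub>R s *\<^sub>R t = (r * s) *\<^sub>R t"
    by (simp add: scaleR_ptensor_def scale)
  show "1 *\<^sub>R t = t"
    by (simp add: scaleR_ptensor_def one)
  show "(norm t = 0) = (t = 0)"
  proof transfer
    fix X :: "nat \<Rightarrow> ('a, 'b) atensor"
    assume X: "pequiv X X"
    show "(lim (\<lambda>n. projective_norm (X n)) = 0) = pequiv X (\<lambda>_. 0)"
    proof
      assume "lim (\<lambda>n. projective_norm (X n)) = 0"
      with lim[OF X] have "(\<lambda>n. projective_norm (X n)) \<longlonglongrightarrow> 0"
        by simp
      with X show "pequiv X (\<lambda>_. 0)"
        by (simp add: pequiv_def pcauchy_const)
    next
      assume "pequiv X (\<lambda>_. 0)"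
      then have "(\<lambda>n. projective_norm (X n)) \<longlonglongrightarrow> 0"
        by (simp add: pequiv_def)
      then show "lim (\<lambda>n. projective_norm (X n)) = 0"
        by (rule limI)
    qed
  qed
  show "norm (t + u) \<le> norm t + norm u"
  proof transfer
    fix X Y :: "nat \<Rightarrow> ('a, 'b) atensor"
    assume X: "pequiv X X" and Y: "pequiv Y Y"
    show "lim (\<lambda>n. projective_norm (X n + Y n))
        \<le> lim (\<lambda>n. projective_norm (X n)) + lim (\<lambda>n. projective_norm (Y n))"
      by (rule LIMSEQ_le[OF lim[OF pequiv_add[OF X Y]] tendsto_add[OF lim[OF X] lim[OF Y]]])
        (auto simp: projective_norm_triangle)
  qed
  show norm: "norm (c *\<^sub>C t) = cmod c * norm t" for c
  proof transfer
    fix c and X :: "nat \<Rightarrow> ('a, 'b) atensor"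
    assume X: "pequiv X X"
    show "lim (\<lambda>n. projective_norm (c *\<^sub>C X n)) = cmod c * lim (\<lambda>n. projective_norm (X n))"
      using tendsto_mult_left[OF lim[OF X], of "cmod c"]
      by (intro limI) (simp add: projective_norm_scaleC)
  qed
  show "norm (r *\<^sub>R t) = \<bar>r\<bar> * norm t"
    by (simp add: scaleR_ptensor_def norm)
qed (simp_all add: dist_ptensor_def sgn_ptensor_def uniformity_ptensor_def open_ptensor_def)

end

lift_definition of_atensor ::
    "('a::complex_normed_vector, 'b::complex_normed_vector) atensor \<Rightarrow> ('a, 'b) ptensor"
  is "\<lambda>t _. t"
  by (intro pequiv_refl pcauchy_const)

definition ptensor :: "'a::complex_normed_vector \<Rightarrow> 'b::complex_normed_vector \<Rightarrow> ('a, 'b) ptensor"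
    (infixr \<open>\<otimes>\<^sub>p\<close> 76)
  where "a \<otimes>\<^sub>p b = of_atensor (atensor a b)"

lemma clinear_of_atensor: "clinear of_atensor"
  unfolding clinear_def by (intro conjI allI; transfer) (simp_all add: pequiv_refl pcauchy_const)

lemma norm_of_atensor: "norm (of_atensor t) = projective_norm t"
  by transfer (rule limI, rule tendsto_const)

lemma of_atensor_tendsto:
  assumes "pequiv X X"
  shows "(\<lambda>n. of_atensor (X n)) \<longlonglongrightarrow> abs_ptensor X"
proof (rule metric_LIMSEQ_I)
  fix e :: real
  assume "0 < e"
  then have "0 < e / 2" by simp
  have "pcauchy X"
    using assms by (simp add: pequiv_def)
  then obtain N where N: "\<And>m n. m \<ge> N \<Longrightarrow> n \<ge> N \<Longrightarrow> projective_norm (X m - X n) < e / 2"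
    using \<open>0 < e / 2\<close> unfolding pcauchy_def by blast
  have "dist (of_atensor (X n)) (abs_ptensor X) < e" if "n \<ge> N" for n
  proof -
    have X': "pequiv (\<lambda>m. (- 1) *\<^sub>C X m) (\<lambda>m. (- 1) *\<^sub>C X m)"
      by (rule pequiv_scaleC[OF assms])
    have S: "pequiv (\<lambda>m. X n + (- 1) *\<^sub>C X m) (\<lambda>m. X n + (- 1) *\<^sub>C X m)"
      by (rule pequiv_add[OF pequiv_refl[OF pcauchy_const] X'])
    have "of_atensor (X n) - abs_ptensor X = abs_ptensor (\<lambda>m. X n + (- 1) *\<^sub>C X m)"
      by (simp add: minus_ptensor_def uminus_ptensor_def of_atensor.abs_eq
          scaleC_ptensor.abs_eq[OF assms] plus_ptensor.abs_eq[OF pequiv_refl[OF pcauchy_const] X'])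
    then have eq: "dist (of_atensor (X n)) (abs_ptensor X) = lim (\<lambda>m. projective_norm (X n - X m))"
      using norm_ptensor.abs_eq[OF S] by (simp add: dist_norm scaleC_minus_one)
    have "(\<lambda>m. projective_norm (X n - X m)) \<longlonglongrightarrow> lim (\<lambda>m. projective_norm (X n - X m))"
      using S pcauchy_norm_convergent
      by (auto simp: pequiv_def convergent_LIMSEQ_iff scaleC_minus_one)
    then have "lim (\<lambda>m. projective_norm (X n - X m)) \<le> e / 2"
      by (rule LIMSEQ_le_const2) (use N[OF that] in \<open>blast intro: less_imp_le\<close>)
    with eq \<open>0 < e\<close> show ?thesis by simp
  qed
  then show "\<exists>N. \<forall>n\<ge>N. dist (of_atensor (X n)) (abs_ptensor X) < e"
    by blast
qed

lemma ptensor_sequence: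
  obtains X where "pequiv X X" "x = abs_ptensor X" "(\<lambda>n. of_atensor (X n)) \<longlonglongrightarrow> x"
proof (rule that)
  show X: "pequiv (rep_ptensor x) (rep_ptensor x)"
    by (rule Quotient_rep_reflp[OF Quotient_ptensor])
  show x: "x = abs_ptensor (rep_ptensor x)"
    by (simp add: Quotient_abs_rep[OF Quotient_ptensor])
  show "(\<lambda>n. of_atensor (rep_ptensor x n)) \<longlonglongrightarrow> x"
    using of_atensor_tendsto[OF X] x by simp
qed

lemma pcauchy_iff: "pcauchy X \<longleftrightarrow> Cauchy (\<lambda>n. of_atensor (X n))"
  by (simp add: pcauchy_def Cauchy_def dist_norm norm_of_atensor flip: clinear_diff[OF clinear_of_atensor])

instance ptensor :: (complex_normed_vector, complex_normed_vector) complex_banach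
proof
  fix S :: "nat \<Rightarrow> ('a, 'b) ptensor"
  assume S: "Cauchy S"
  have "\<exists>t. dist (of_atensor t) (S n) < inverse (real (Suc n))" for n
  proof -
    obtain X where X: "(\<lambda>k. of_atensor (X k)) \<longlonglongrightarrow> S n"
      by (rule ptensor_sequence)
    obtain k where "\<forall>j\<ge>k. dist (of_atensor (X j)) (S n) < inverse (real (Suc n))"
      using metric_LIMSEQ_D[OF X, of "inverse (real (Suc n))"] by auto
    then show ?thesis by blast
  qed
  then obtain Y where Y: "\<And>n. dist (of_atensor (Y n)) (S n) < inverse (real (Suc n))"
    by metis
  have diff: "(\<lambda>n. of_atensor (Y n) - S n) \<longlonglongrightarrow> 0"
    by (rule tendsto_norm_zero_cancel, rule null_le[OF LIMSEQ_inverse_real_of_nat])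
      (use Y in \<open>auto simp: dist_norm less_imp_le\<close>)
  have "Cauchy (\<lambda>n. of_atensor (Y n))"
  proof (rule metric_CauchyI)
    fix e :: real
    assume "0 < e"
    then have "0 < e / 3" by simp
    obtain M where M: "\<And>m n. m \<ge> M \<Longrightarrow> n \<ge> M \<Longrightarrow> dist (S m) (S n) < e / 3"
      using metric_CauchyD[OF S \<open>0 < e / 3\<close>] by blast
    obtain N where N: "\<And>n. n \<ge> N \<Longrightarrow> dist (of_atensor (Y n)) (S n) < e / 3"
      using metric_LIMSEQ_D[OF diff \<open>0 < e / 3\<close>] by (auto simp: dist_norm)
    have "dist (of_atensor (Y m)) (of_atensor (Y n)) < e" if "m \<ge> max M N" "n \<ge> max M N" for m n
      using M[of m n] N[of m] N[of n] that
        dist_triangle[of "of_atensor (Y m)" "of_atensor (Y n)" "S m"]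
        dist_triangle[of "S m" "of_atensor (Y n)" "S n"] dist_commute[of "of_atensor (Y n)" "S n"]
      by simp
    then show "\<exists>N. \<forall>m\<ge>N. \<forall>n\<ge>N. dist (of_atensor (Y m)) (of_atensor (Y n)) < e"
      by blast
  qed
  then have "pcauchy Y"
    by (simp add: pcauchy_iff)
  from of_atensor_tendsto[OF pequiv_refl[OF this]] diff
  have "(\<lambda>n. of_atensor (Y n) - (of_atensor (Y n) - S n)) \<longlonglongrightarrow> abs_ptensor Y - 0"
    by (rule tendsto_diff)
  then show "convergent S"
    by (auto simp: convergent_def)
qed

lemma clinear_ptensor_left: "clinear (\<lambda>a. a \<otimes>\<^sub>p b)"
  and clinear_ptensor_right: "clinear (\<lambda>b. a \<otimes>\<^sub>p b)"
  by (simp_all add: clinear_def ptensor_def atensor_add_left atensor_add_right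
      clinear_add[OF clinear_of_atensor] clinear_scaleC[OF clinear_of_atensor, symmetric]
      atensor_scaleC flip: atensor_scaleC_right)

lemma norm_ptensor_le: "norm (a \<otimes>\<^sub>p b) \<le> norm a * norm b"
  by (simp add: ptensor_def norm_of_atensor projective_norm_atensor)

lemma bounded_cbilinear_ptensor: "bounded_cbilinear (\<otimes>\<^sub>p)"
  using norm_ptensor_le unfolding bounded_cbilinear_def
  by (auto simp: clinear_ptensor_left clinear_ptensor_right intro!: exI[of _ 1])

lemma ptensor_eqI:
  fixes T U :: "('a::complex_normed_vector, 'b::complex_normed_vector) ptensor \<Rightarrow> 'c::complex_normed_vector"
  assumes T: "bounded_clinear T" and U: "bounded_clinear U"
    and eq: "\<And>a b. T (a \<otimes>\<^sub>p b) = U (a \<otimes>\<^sub>p b)"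
  shows "T = U"
proof
  fix x :: "('a, 'b) ptensor"
  have T': "clinear T" and U': "clinear U"
    using T U by (simp_all add: bounded_clinear_clinear)
  have atensor: "T (of_atensor t) = U (of_atensor t)" for t
    by (induction t rule: atensor_induct)
      (simp_all add: clinear_zero[OF clinear_of_atensor] clinear_add[OF clinear_of_atensor]
        clinear_zero[OF T'] clinear_zero[OF U'] clinear_add[OF T'] clinear_add[OF U']
        eq flip: ptensor_def)
  obtain X where X: "(\<lambda>n. of_atensor (X n)) \<longlonglongrightarrow> x"
    by (rule ptensor_sequence)
  have "(\<lambda>n. T (of_atensor (X n))) \<longlonglongrightarrow> T x" "(\<lambda>n. U (of_atensor (X n))) \<longlonglongrightarrow> U x"
    by (rule bounded_linear.tendsto[OF bounded_clinear_bounded_linear[OF T] X],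
        rule bounded_linear.tendsto[OF bounded_clinear_bounded_linear[OF U] X])
  then show "T x = U x"
    unfolding atensor by (rule LIMSEQ_unique)
qed

theorem ptensor_universal:
  fixes B :: "'a::complex_normed_vector \<Rightarrow> 'b::complex_normed_vector \<Rightarrow> 'c::complex_banach"
  assumes "bounded_cbilinear B"
  shows "\<exists>!T. bounded_clinear T \<and> (\<forall>a b. T (a \<otimes>\<^sub>p b) = B a b)"
proof -
  have "\<exists>T. clinear T \<and> (\<forall>a b. T (atensor a b) = B a b)"
    using assms by (intro atensor_universal) (auto simp: bounded_cbilinear_def)
  then obtain T where T: "clinear T" and TB: "\<And>a b. T (atensor a b) = B a b"
    by blast
  obtain K where K: "\<And>a b. norm (B a b) \<le> K * (norm a * norm b)"
    using assms by (auto simp: bounded_cbilinear_def)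
  define L where "L = max K 1"
  have "L > 0" by (simp add: L_def)
  have L: "norm (B a b) \<le> L * (norm a * norm b)" for a b
    using K[of a b] mult_right_mono[of K L "norm a * norm b"] by (simp add: L_def)
  have bound: "norm (T t) \<le> L * projective_norm t" for t
  proof -
    have "norm (T t) / L \<le> projective_norm t"
    proof (rule projective_norm_greatest)
      fix xs
      assume t: "t = (\<Sum>(a, b)\<leftarrow>xs. atensor a b)"
      have "norm (T t) \<le> L * (\<Sum>(a, b)\<leftarrow>xs. norm a * norm b)"
        unfolding t
      proof (induction xs)
        case Nil
        then show ?case by (simp add: clinear_zero[OF T])
      next
        case (Cons x xs)
        obtain a b where "x = (a, b)" by (cases x)
        then show ?case
          using Cons.IH L[of a b] norm_triangle_ineq[of "B a b" "T (\<Sum>(a, b)\<leftarrow>xs. atensor a b)"]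
          by (simp add: clinear_add[OF T] TB algebra_simps)
      qed
      then show "norm (T t) / L \<le> (\<Sum>(a, b)\<leftarrow>xs. norm a * norm b)"
        using \<open>L > 0\<close> by (simp add: field_simps)
    qed
    then show ?thesis
      using \<open>L > 0\<close> by (simp add: field_simps)
  qed
  have Cauchy: "Cauchy (\<lambda>n. T (X n))" if "pcauchy X" for X
    unfolding Cauchy_def dist_norm
  proof (intro allI impI)
    fix e :: real
    assume "0 < e"
    then have "0 < e / L" using \<open>L > 0\<close> by simp
    then obtain N where N: "\<And>m n. m \<ge> N \<Longrightarrow> n \<ge> N \<Longrightarrow> projective_norm (X m - X n) < e / L"
      using \<open>pcauchy X\<close> unfolding pcauchy_def by blast
    have "norm (T (X m) - T (X n)) < e" if "m \<ge> N" "n \<ge> N" for m n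
      using bound[of "X m - X n"] N[OF that] \<open>L > 0\<close>
      by (simp add: clinear_diff[OF T] field_simps)
    then show "\<exists>N. \<forall>m\<ge>N. \<forall>n\<ge>N. norm (T (X m) - T (X n)) < e"
      by blast
  qed
  have "\<exists>z. \<forall>X. (\<lambda>n. of_atensor (X n)) \<longlonglongrightarrow> x \<longrightarrow> (\<lambda>n. T (X n)) \<longlonglongrightarrow> z"
    for x :: "('a, 'b) ptensor"
  proof -
    obtain X where X: "pequiv X X" "(\<lambda>n. of_atensor (X n)) \<longlonglongrightarrow> x"
      by (rule ptensor_sequence)
    obtain z where z: "(\<lambda>n. T (X n)) \<longlonglongrightarrow> z"
      using Cauchy[of X] X(1) by (auto simp: pequiv_def Cauchy_convergent_iff convergent_def)
    have "(\<lambda>n. T (Y n)) \<longlonglongrightarrow> z" if Y: "(\<lambda>n. of_atensor (Y n)) \<longlonglongrightarrow> x" for Y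
    proof -
      have "(\<lambda>n. of_atensor (Y n) - of_atensor (X n)) \<longlonglongrightarrow> 0"
        using tendsto_diff[OF Y X(2)] by simp
      then have "(\<lambda>n. projective_norm (Y n - X n)) \<longlonglongrightarrow> 0"
        using tendsto_norm_zero by (force simp: norm_of_atensor simp flip: clinear_diff[OF clinear_of_atensor])
      then have "(\<lambda>n. L * projective_norm (Y n - X n)) \<longlonglongrightarrow> 0"
        by (rule tendsto_mult_right_zero)
      then have "(\<lambda>n. norm (T (Y n - X n))) \<longlonglongrightarrow> 0"
        by (rule null_le) (auto simp: bound)
      then have "(\<lambda>n. T (Y n) - T (X n)) \<longlonglongrightarrow> 0"
        by (simp add: tendsto_norm_zero_iff clinear_diff[OF T])
      from tendsto_add[OF this z] show ?thesis by simp
    qed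
    then show ?thesis by blast
  qed
  then obtain U where U: "\<And>x X. (\<lambda>n. of_atensor (X n)) \<longlonglongrightarrow> x \<Longrightarrow> (\<lambda>n. T (X n)) \<longlonglongrightarrow> U x"
    by metis
  have seq: "\<exists>X. (\<lambda>n. of_atensor (X n)) \<longlonglongrightarrow> x" for x :: "('a, 'b) ptensor"
    by (rule ptensor_sequence[of x]) blast
  have UT: "U (of_atensor t) = T t" for t
    using LIMSEQ_unique[OF U[of "\<lambda>_. t" "of_atensor t"] tendsto_const] by simp
  have "clinear U"
    unfolding clinear_def
  proof (intro conjI allI)
    fix x y :: "('a, 'b) ptensor" and c
    obtain X where X: "(\<lambda>n. of_atensor (X n)) \<longlonglongrightarrow> x"
      using seq by blast
    obtain Y where Y: "(\<lambda>n. of_atensor (Y n)) \<longlonglongrightarrow> y"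
      using seq by blast
    have "(\<lambda>n. of_atensor (X n + Y n)) \<longlonglongrightarrow> x + y"
      using tendsto_add[OF X Y] by (simp add: clinear_add[OF clinear_of_atensor])
    from U[OF this] tendsto_add[OF U[OF X] U[OF Y]]
    show "U (x + y) = U x + U y"
      unfolding clinear_add[OF T] by (rule LIMSEQ_unique)
    have "(\<lambda>n. of_atensor (c *\<^sub>C X n)) \<longlonglongrightarrow> c *\<^sub>C x"
      unfolding clinear_scaleC[OF clinear_of_atensor]
      by (rule bounded_linear.tendsto[OF bounded_linear_scaleC_right X])
    from U[OF this] bounded_linear.tendsto[OF bounded_linear_scaleC_right[of c] U[OF X]]
    show "U (c *\<^sub>C x) = c *\<^sub>C U x"
      unfolding clinear_scaleC[OF T] by (rule LIMSEQ_unique)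
  qed
  moreover have "norm (U x) \<le> L * norm x" for x :: "('a, 'b) ptensor"
  proof -
    obtain X where X: "(\<lambda>n. of_atensor (X n)) \<longlonglongrightarrow> x"
      using seq by blast
    have "(\<lambda>n. norm (T (X n))) \<longlonglongrightarrow> norm (U x)"
      by (rule tendsto_norm[OF U[OF X]])
    moreover have "(\<lambda>n. L * norm (of_atensor (X n))) \<longlonglongrightarrow> L * norm x"
      by (rule tendsto_mult_left[OF tendsto_norm[OF X]])
    moreover have "\<exists>N. \<forall>n\<ge>N. norm (T (X n)) \<le> L * norm (of_atensor (X n))"
      by (simp add: norm_of_atensor bound)
    ultimately show ?thesis
      by (rule LIMSEQ_le)
  qed
  ultimately have U_bounded: "bounded_clinear U"
    unfolding bounded_clinear_def by blast
  have UB: "U (a \<otimes>\<^sub>p b) = B a b" for a b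
    by (simp add: ptensor_def UT TB)
  show ?thesis
  proof (rule ex1I[of _ U])
    show "bounded_clinear U \<and> (\<forall>a b. U (a \<otimes>\<^sub>p b) = B a b)"
      using U_bounded UB by blast
    fix V
    assume "bounded_clinear V \<and> (\<forall>a b. V (a \<otimes>\<^sub>p b) = B a b)"
    then show "V = U"
      using U_bounded by (intro ptensor_eqI) (simp_all add: UB)
  qed
qed

text \<open>
  The bounded linear map given by its values on elementary tensors; it exists and is unique
  if these values are a bounded bilinear map.
\<close>

definition ptensor_lift :: "('a::complex_normed_vector \<Rightarrow> 'b::complex_normed_vector \<Rightarrow> 'c::complex_banach)
    \<Rightarrow> ('a, 'b) ptensor \<Rightarrow> 'c"
  where "ptensor_lift B = (THE T. bounded_clinear T \<and> (\<forall>a b. T (a \<otimes>\<^sub>p b) = B a b))"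

lemma
  assumes "bounded_cbilinear B"
  shows bounded_clinear_ptensor_lift: "bounded_clinear (ptensor_lift B)"
    and ptensor_lift_ptensor: "ptensor_lift B (a \<otimes>\<^sub>p b) = B a b"
  using theI'[OF ptensor_universal[OF assms]] by (simp_all add: ptensor_lift_def)


section \<open>Biflatness\<close>

definition tensor_lact :: "'a::complex_banach_algebra \<Rightarrow> ('a, 'a) ptensor \<Rightarrow> ('a, 'a) ptensor"
  where "tensor_lact a = ptensor_lift (\<lambda>b c. (a * b) \<otimes>\<^sub>p c)"

definition tensor_ract :: "('a, 'a) ptensor \<Rightarrow> 'a::complex_banach_algebra \<Rightarrow> ('a, 'a) ptensor"
  where "tensor_ract x a = ptensor_lift (\<lambda>b c. b \<otimes>\<^sub>p (c * a)) x"

definition diagonal_operator :: "('a::complex_banach_algebra, 'a) ptensor \<Rightarrow> 'a"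
  where "diagonal_operator = ptensor_lift (*)"

lemma clinear_mult_left: "clinear (\<lambda>x. a * x :: 'a::complex_banach_algebra)"
  and clinear_mult_right: "clinear (\<lambda>x. x * a :: 'a::complex_banach_algebra)"
  by (simp_all add: clinear_def algebra_simps scaleC_mult_left scaleC_mult_right)

lemma bounded_clinear_mult_left: "bounded_clinear (\<lambda>x. a * x :: 'a::complex_banach_algebra)"
  and bounded_clinear_mult_right: "bounded_clinear (\<lambda>x. x * a :: 'a::complex_banach_algebra)"
  unfolding bounded_clinear_def
  by (auto simp: clinear_mult_left clinear_mult_right norm_mult_ineq mult.commute[of _ "norm a"]
      intro!: exI[of _ "norm a"] intro: order_trans[OF norm_mult_ineq])

lemma bounded_cbilinear_mult: "bounded_cbilinear ((*) :: 'a \<Rightarrow> 'a \<Rightarrow> 'a::complex_banach_algebra)"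
  unfolding bounded_cbilinear_def
  by (auto simp: clinear_mult_left clinear_mult_right norm_mult_ineq intro!: exI[of _ 1])

lemma bounded_cbilinear_lact:
  "bounded_cbilinear (\<lambda>b c. (a * b) \<otimes>\<^sub>p c :: ('a::complex_banach_algebra, 'a) ptensor)"
proof -
  have le: "norm ((a * b) \<otimes>\<^sub>p c) \<le> norm a * (norm b * norm c)" for b c :: 'a
    using norm_ptensor_le[of "a * b" c] mult_right_mono[OF norm_mult_ineq[of a b], of "norm c"]
    by (simp add: mult.assoc)
  have "\<exists>K. \<forall>(b :: 'a) (c :: 'a). norm ((a * b) \<otimes>\<^sub>p c) \<le> K * (norm b * norm c)"
    by (intro exI[of _ "norm a"] allI le)
  then show ?thesis
    unfolding bounded_cbilinear_def
    by (simp add: clinear_def algebra_simps scaleC_mult_right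
        clinear_add[OF clinear_ptensor_left] clinear_scaleC[OF clinear_ptensor_left]
        clinear_add[OF clinear_ptensor_right] clinear_scaleC[OF clinear_ptensor_right])
qed

lemma bounded_cbilinear_ract:
  "bounded_cbilinear (\<lambda>b c. b \<otimes>\<^sub>p (c * a) :: ('a::complex_banach_algebra, 'a) ptensor)"
proof -
  have le: "norm (b \<otimes>\<^sub>p (c * a)) \<le> norm a * (norm b * norm c)" for b c :: 'a
    using norm_ptensor_le[of b "c * a"] mult_left_mono[OF norm_mult_ineq[of c a], of "norm b"]
    by (simp add: ac_simps)
  have "\<exists>K. \<forall>(b :: 'a) (c :: 'a). norm (b \<otimes>\<^sub>p (c * a)) \<le> K * (norm b * norm c)"
    by (intro exI[of _ "norm a"] allI le)
  then show ?thesis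
    unfolding bounded_cbilinear_def
    by (simp add: clinear_def algebra_simps scaleC_mult_left
        clinear_add[OF clinear_ptensor_left] clinear_scaleC[OF clinear_ptensor_left]
        clinear_add[OF clinear_ptensor_right] clinear_scaleC[OF clinear_ptensor_right])
qed

lemma
  shows bounded_clinear_tensor_lact: "bounded_clinear (tensor_lact a)"
    and tensor_lact_ptensor: "tensor_lact a (b \<otimes>\<^sub>p c) = (a * b) \<otimes>\<^sub>p c"
    and bounded_clinear_tensor_ract: "bounded_clinear (\<lambda>x. tensor_ract x a)"
    and tensor_ract_ptensor: "tensor_ract (b \<otimes>\<^sub>p c) a = b \<otimes>\<^sub>p (c * a)"
    and bounded_clinear_diagonal_operator:
      "bounded_clinear (diagonal_operator :: ('a::complex_banach_algebra, 'a) ptensor \<Rightarrow> 'a)"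
    and diagonal_operator_ptensor: "diagonal_operator (b \<otimes>\<^sub>p c) = b * c"
  by (simp_all add: tensor_lact_def tensor_ract_def diagonal_operator_def
      bounded_clinear_ptensor_lift ptensor_lift_ptensor
      bounded_cbilinear_lact bounded_cbilinear_ract bounded_cbilinear_mult)

definition continuous_homs :: "('a::complex_banach_algebra \<Rightarrow> 'a) set"
  where "continuous_homs =
    {\<sigma>. clinear \<sigma> \<and> (\<forall>x y. \<sigma> (x * y) = \<sigma> x * \<sigma> y) \<and> continuous_on UNIV \<sigma>}"

lemma continuous_homs_bounded_clinear:
  assumes "\<sigma> \<in> continuous_homs"
  shows "bounded_clinear \<sigma>"
proof -
  have \<sigma>: "clinear \<sigma>" "isCont \<sigma> 0"
    using assms by (auto simp: continuous_homs_def continuous_on_eq_continuous_at)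
  then obtain d where "d > 0" and d: "\<And>x. norm x < d \<Longrightarrow> norm (\<sigma> x) < 1"
    using clinear_zero[OF \<sigma>(1)] unfolding continuous_at_eps_delta
    by (metis dist_0_norm dist_commute zero_less_one)
  have "norm (\<sigma> x) \<le> (2 / d) * norm x" for x
  proof (cases "x = 0")
    case True
    then show ?thesis by (simp add: clinear_zero[OF \<sigma>(1)])
  next
    case False
    define r where "r = d / (2 * norm x)"
    have r: "r > 0" "r * norm x < d" using \<open>d > 0\<close> False by (simp_all add: r_def)
    have "norm (\<sigma> (r *\<^sub>R x)) < 1"
      using r by (intro d) simp
    then have "r * norm (\<sigma> x) < 1"
      using r(1) by (simp add: linear_scale[OF clinear_imp_linear[OF \<sigma>(1)]])
    then show ?thesis
      using \<open>d > 0\<close> False by (simp add: r_def field_simps)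
  qed
  with \<sigma>(1) show ?thesis
    unfolding bounded_clinear_def by blast
qed

definition biflat :: "'a::complex_banach_algebra itself \<Rightarrow> bool"
  where "biflat _ \<longleftrightarrow> (\<exists>\<rho> :: ('a, 'a) ptensor dual \<Rightarrow> 'a dual.
    bounded_clinear \<rho> \<and>
    (\<forall>a l. \<rho> (dual_lact tensor_ract a l) = dual_lact (*) a (\<rho> l)) \<and>
    (\<forall>a l. \<rho> (dual_ract tensor_lact l a) = dual_ract (*) (\<rho> l) a) \<and>
    (\<forall>f. \<rho> (dual_map diagonal_operator f) = f))"

definition sigma_biflat :: "('a::complex_banach_algebra \<Rightarrow> 'a) \<Rightarrow> bool"
  where "sigma_biflat \<sigma> \<longleftrightarrow> (\<exists>\<rho> :: ('a, 'a) ptensor dual \<Rightarrow> 'a dual.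
    bounded_clinear \<rho> \<and>
    (\<forall>a l. \<rho> (dual_lact tensor_ract (\<sigma> a) l) = dual_lact (*) a (\<rho> l)) \<and>
    (\<forall>a l. \<rho> (dual_ract tensor_lact l (\<sigma> a)) = dual_ract (*) (\<rho> l) a) \<and>
    (\<forall>f. \<rho> (dual_map diagonal_operator f) = dual_map \<sigma> f))"

text \<open>
  A bounded two-sided approximate identity, with the filter of tails of a bounded net in place
  of the net.
\<close>

definition has_bounded_approximate_identity :: "'a::complex_banach_algebra itself \<Rightarrow> bool"
  where "has_bounded_approximate_identity _ \<longleftrightarrow> (\<exists>F :: 'a filter. F \<noteq> bot \<and>
    (\<exists>M. \<forall>\<^sub>F e in F. norm e \<le> M) \<and>
    (\<forall>a. ((\<lambda>e. a * e) \<longlongrightarrow> a) F) \<and> (\<forall>a. ((\<lambda>e. e * a) \<longlongrightarrow> a) F))"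

end

theory Submission
  imports Defs
begin

text \<open>
  Part (i) takes a bimodule left inverse \<open>\<rho>\<close> of \<open>\<pi>\<^sup>*\<close> and composes it with \<open>\<sigma>\<^sup>*\<close>: since \<open>\<sigma>\<close> is
  multiplicative, \<open>\<sigma>\<^sup>*(\<sigma>(a) \<cdot> f) = a \<cdot> \<sigma>\<^sup>*(f)\<close>, and similarly on the right.

  For part (ii), let \<open>\<rho>\<close> witness \<open>\<sigma>\<close>-biflatness. A left inverse \<open>\<tau>\<close> of \<open>\<pi>\<^sup>*\<close> with \<open>\<sigma>\<^sup>* \<circ> \<tau> = \<rho>\<close> is
  wanted, that is, \<open>\<langle>\<tau>(\<lambda>), \<sigma>(a)\<rangle> = \<langle>\<rho>(\<lambda>), a\<rangle>\<close>. As \<open>\<sigma>\<close> has dense range, this prescribes \<open>\<tau>(\<lambda>)\<close>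
  on a dense subspace, and such a functional exists (lemma \<open>dense_range_factorization\<close>) as soon as
  \<open>|\<langle>\<rho>(\<lambda>), a\<rangle>| \<le> K \<parallel>\<lambda>\<parallel> \<parallel>\<sigma>(a)\<parallel>\<close>. The approximate identity gives this bound
  (lemma \<open>sigma_biflat_bound\<close>): with \<open>\<parallel>e\<parallel> \<le> M\<close>,
  \<open>|\<langle>\<rho>(\<lambda>), e a\<rangle>| = |\<langle>a \<cdot> \<rho>(\<lambda>), e\<rangle>| = |\<langle>\<rho>(\<sigma>(a) \<cdot> \<lambda>), e\<rangle>| \<le> \<parallel>\<rho>\<parallel> \<parallel>\<sigma>(a)\<parallel> \<parallel>\<lambda>\<parallel> M\<close>,
  and \<open>e a\<close> tends to \<open>a\<close>. That \<open>\<tau>\<close> is linear, a bimodule homomorphism and a left inverse of \<open>\<pi>\<^sup>*\<close> may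
  be checked on the range of \<open>\<sigma>\<close>, where these are properties of \<open>\<rho>\<close>; for the module identities this
  uses that the actions on \<open>(A \<otimes> A)\<^sup>*\<close> are norm continuous in the algebra
  variable (lemmas \<open>bounded_clinear_dual_lact\<close> and \<open>bounded_clinear_dual_ract\<close>).
\<close>

section \<open>Dual spaces\<close>

lemma dual_eqI: "(\<And>x. dual_apply f x = dual_apply g x) \<Longrightarrow> f = g"
  by (simp add: dual_apply_inject[symmetric] fun_eq_iff)

lemma clinear_dual_apply: "clinear (dual_apply f)"
  by (intro bounded_clinear_clinear bounded_clinear_dual_apply)

lemma norm_dual_apply_le: "norm (dual_apply f x) \<le> norm f * norm x"
  unfolding norm_dual.rep_eq
  by (rule onorm[OF bounded_clinear_bounded_linear[OF bounded_clinear_dual_apply]])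

lemma norm_dual_le:
  assumes "0 \<le> K" "\<And>x. norm (dual_apply f x) \<le> K * norm x"
  shows "norm f \<le> K"
  unfolding norm_dual.rep_eq using assms by (intro onorm_bound) auto

lemma dual_apply_continuous: "continuous_on UNIV (dual_apply f)"
  by (intro linear_continuous_on bounded_clinear_bounded_linear bounded_clinear_dual_apply)

lemma bounded_linear_dual_apply_left: "bounded_linear (\<lambda>f. dual_apply f x)"
  by (rule bounded_linear_intro[where K = "norm x"])
    (auto simp: plus_dual.rep_eq scaleR_dual.rep_eq scaleR_conv_of_real norm_dual_apply_le)

lemma bounded_clinear_dual_map:
  fixes T :: "'a::complex_normed_vector \<Rightarrow> 'b::complex_normed_vector"
  assumes T: "bounded_clinear T"
  shows "bounded_clinear (dual_map T)"
proof -
  obtain K where K: "K \<ge> 0" "\<And>x. norm (T x) \<le> K * norm x"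
    using bounded_linear.nonneg_bounded[OF bounded_clinear_bounded_linear[OF T]]
    by (auto simp: mult.commute)
  have "norm (dual_map T f) \<le> K * norm f" for f
  proof (rule norm_dual_le)
    fix x
    have "norm (dual_apply f (T x)) \<le> norm f * (K * norm x)"
      by (rule order_trans[OF norm_dual_apply_le mult_left_mono[OF K(2)]]) simp
    then show "norm (dual_apply (dual_map T f) x) \<le> K * norm f * norm x"
      by (simp add: dual_map_apply[OF T] ac_simps)
  qed (simp add: K)
  moreover have "clinear (dual_map T)"
    unfolding clinear_def
    by (auto intro!: dual_eqI simp: dual_map_apply[OF T] plus_dual.rep_eq scaleC_dual.rep_eq)
  ultimately show ?thesis
    unfolding bounded_clinear_def by blast
qed


section \<open>Maps into spaces with a dense range\<close>

lemma continuous_eq_on_dense_range: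
  fixes f g :: "'a::topological_space \<Rightarrow> 'b::t2_space"
  assumes "continuous_on UNIV f" "continuous_on UNIV g" "closure (range S) = UNIV"
    and "\<And>a. f (S a) = g (S a)"
  shows "f x = g x"
proof -
  have "closed {x. f x = g x}"
    using assms(1,2) by (rule closed_Collect_eq)
  then have "closure (range S) \<subseteq> {x. f x = g x}"
    using assms(4) by (intro closure_minimal) auto
  with assms(3) show ?thesis by auto
qed

text \<open>
  A linear map \<open>T\<close> that is dominated in norm by a linear map \<open>S\<close> with dense range factors through
  \<open>S\<close>. The domain needs no norm.
\<close>

lemma dense_range_factorization:
  fixes S :: "'a::complex_vector \<Rightarrow> 'b::complex_normed_vector" and T :: "'a \<Rightarrow> 'c::complex_banach"
  assumes S: "clinear S" and T: "clinear T" and dense: "closure (range S) = UNIV"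
    and le: "\<And>a. norm (T a) \<le> K * norm (S a)"
  obtains U where "bounded_clinear U" "\<And>a. U (S a) = T a" "\<And>y. norm (U y) \<le> K * norm y"
proof -
  define f where "f y = T (inv S y)" for y
  have lip: "norm (T a - T b) \<le> K * norm (S a - S b)" for a b
    using le[of "a - b"] by (simp add: clinear_diff[OF S] clinear_diff[OF T])
  \<comment> \<open>The choice of preimage does not matter: by the bound, \<open>S a = S b\<close> implies \<open>T a = T b\<close>.\<close>
  have f: "f (S a) = T a" for a
    using lip[of "inv S (S a)" a] by (simp add: f_def f_inv_into_f)
  have "uniformly_continuous_on (range S) f"
    unfolding uniformly_continuous_on_def
  proof (intro allI impI)
    fix e :: real
    assume "e > 0"
    \<comment> \<open>\<open>|K| + 1\<close> because \<open>K\<close> is an arbitrary real, and a positive divisor is needed\<close>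
    show "\<exists>d>0. \<forall>x\<in>range S. \<forall>x'\<in>range S. dist x' x < d \<longrightarrow> dist (f x') (f x) < e"
    proof (intro exI[of _ "e / (\<bar>K\<bar> + 1)"] conjI)
      have "dist (T a) (T b) < e" if "dist (S a) (S b) < e / (\<bar>K\<bar> + 1)" for a b
      proof -
        have "norm (T a - T b) \<le> (\<bar>K\<bar> + 1) * norm (S a - S b)"
          by (rule order_trans[OF lip mult_right_mono]) auto
        also have "\<dots> < e"
          using that by (simp add: dist_norm pos_less_divide_eq mult.commute)
        finally show ?thesis by (simp add: dist_norm)
      qed
      then show "\<forall>x\<in>range S. \<forall>x'\<in>range S. dist x' x < e / (\<bar>K\<bar> + 1) \<longrightarrow> dist (f x') (f x) < e"
        by (auto simp: f)
    qed (use \<open>e > 0\<close> in auto)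
  qed
  then obtain U where "uniformly_continuous_on (closure (range S)) U"
      and Uf: "\<And>y. y \<in> range S \<Longrightarrow> f y = U y"
    by (rule uniformly_continuous_on_extension_on_closure) blast
  then have cont: "continuous_on UNIV U"
    using dense uniformly_continuous_imp_continuous by metis
  have comp: "continuous_on UNIV (\<lambda>y. U (h y))" if "continuous_on UNIV h" for h :: "'b \<Rightarrow> 'b"
    by (rule continuous_on_compose2[OF cont that]) simp
  have US: "U (S a) = T a" for a
    using Uf[of "S a"] f[of a] by simp
  have add_S: "U (S a + y) = U (S a) + U y" for a y
    by (rule continuous_eq_on_dense_range[OF _ _ dense])
      (auto intro!: comp continuous_intros cont
        simp: US clinear_add[OF T] simp flip: clinear_add[OF S])
  have add: "U (x + y) = U x + U y" for x y
    by (rule continuous_eq_on_dense_range[OF _ _ dense, where x = x])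
      (auto intro!: comp continuous_intros cont simp: add_S)
  have cont_scaleC: "continuous_on UNIV (\<lambda>y::'d::complex_normed_vector. c *\<^sub>C y)" for c
    by (intro linear_continuous_on bounded_linear_scaleC_right)
  have scale: "U (c *\<^sub>C y) = c *\<^sub>C U y" for c y
    by (rule continuous_eq_on_dense_range[OF _ _ dense, where x = y])
      (auto intro!: comp cont_scaleC continuous_on_compose2[OF cont_scaleC cont]
        simp: US clinear_scaleC[OF T] simp flip: clinear_scaleC[OF S])
  have bound: "norm (U y) \<le> K * norm y" for y
  proof -
    have "closed {y. norm (U y) \<le> K * norm y}"
      by (intro closed_Collect_le continuous_intros cont)
    then have "closure (range S) \<subseteq> {y. norm (U y) \<le> K * norm y}"
      using le by (intro closure_minimal) (auto simp: US)
    with dense show ?thesis by auto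
  qed
  show ?thesis
    by (rule that[OF _ US bound]) (use add scale bound in \<open>auto simp: bounded_clinear_def clinear_def\<close>)
qed


section \<open>The module actions on the dual of the projective tensor product\<close>

text \<open>
  The norm of a map on the projective tensor product is controlled by its values on elementary
  tensors: the bound holds for each finite representation, hence for the infimum over them, and
  extends to the completion by continuity.
\<close>

lemma norm_ptensor_map_le:
  fixes T :: "('a::complex_normed_vector, 'b::complex_normed_vector) ptensor \<Rightarrow> 'c::complex_normed_vector"
  assumes T: "bounded_clinear T" and "K \<ge> 0"
    and le: "\<And>a b. norm (T (a \<otimes>\<^sub>p b)) \<le> K * (norm a * norm b)"
  shows "norm (T x) \<le> K * norm x"
proof -
  have T': "clinear T" using T by (rule bounded_clinear_clinear)
  have sum: "norm (T (of_atensor (\<Sum>(a, b)\<leftarrow>xs. atensor a b))) \<le> K * (\<Sum>(a, b)\<leftarrow>xs. norm a * norm b)"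
    for xs
  proof (induction xs)
    case Nil
    show ?case by (simp add: clinear_zero[OF T'] clinear_zero[OF clinear_of_atensor])
  next
    case (Cons p xs)
    obtain a b where "p = (a, b)" by (cases p)
    then show ?case
      using norm_triangle_le[OF add_mono[OF le[of a b] Cons.IH]]
      by (simp add: clinear_add[OF T'] clinear_add[OF clinear_of_atensor] ptensor_def algebra_simps)
  qed
  have atensor: "norm (T (of_atensor t)) \<le> K * norm (of_atensor t)" for t
  proof (cases "K = 0")
    case True
    obtain xs where "t = (\<Sum>(a, b)\<leftarrow>xs. atensor a b)"
      using atensor_representation by blast
    with sum[of xs] True show ?thesis by simp
  next
    case False
    with \<open>K \<ge> 0\<close> have "K > 0" by simp
    then have "norm (T (of_atensor t)) / K \<le> projective_norm t"
      using sum by (intro projective_norm_greatest) (auto simp: pos_divide_le_eq mult.commute)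
    with \<open>K > 0\<close> show ?thesis
      by (simp add: norm_of_atensor pos_divide_le_eq mult.commute)
  qed
  obtain X where X: "(\<lambda>n. of_atensor (X n)) \<longlonglongrightarrow> x"
    by (rule ptensor_sequence)
  show ?thesis
    using bounded_linear.tendsto[OF bounded_clinear_bounded_linear[OF T] X]
    by (intro LIMSEQ_le[OF tendsto_norm tendsto_mult_left[OF tendsto_norm[OF X]]])
      (auto simp: atensor)
qed

lemma norm_tensor_ract_le: "norm (tensor_ract x a) \<le> norm a * norm x"
proof (rule norm_ptensor_map_le[where T = "\<lambda>x. tensor_ract x a", OF bounded_clinear_tensor_ract])
  fix b c :: 'a
  show "norm (tensor_ract (b \<otimes>\<^sub>p c) a) \<le> norm a * (norm b * norm c)"
    using norm_ptensor_le[of b "c * a"] mult_left_mono[OF norm_mult_ineq[of c a], of "norm b"]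
    by (simp add: tensor_ract_ptensor ac_simps)
qed simp

lemma norm_tensor_lact_le: "norm (tensor_lact a x) \<le> norm a * norm x"
proof (rule norm_ptensor_map_le[OF bounded_clinear_tensor_lact])
  fix b c :: 'a
  show "norm (tensor_lact a (b \<otimes>\<^sub>p c)) \<le> norm a * (norm b * norm c)"
    using norm_ptensor_le[of "a * b" c] mult_right_mono[OF norm_mult_ineq[of a b], of "norm c"]
    by (simp add: tensor_lact_ptensor ac_simps)
qed simp

lemma bounded_clinear_add:
  assumes "bounded_clinear f" "bounded_clinear g"
  shows "bounded_clinear (\<lambda>x. f x + g x)"
  using assms by (auto simp: bounded_clinear_iff bounded_linear_add scaleC_add_right)

lemma bounded_clinear_scaleC:
  assumes "bounded_clinear f"
  shows "bounded_clinear (\<lambda>x. c *\<^sub>C f x)"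
  using assms bounded_linear_compose[OF bounded_linear_scaleC_right, of f]
  by (auto simp: bounded_clinear_iff scaleC_scaleC mult.commute)

lemma clinear_tensor_ract: "clinear (tensor_ract (x :: ('a::complex_banach_algebra, 'a) ptensor))"
  unfolding clinear_def
proof (intro conjI allI)
  fix a b :: 'a and c
  have "(\<lambda>x. tensor_ract x (a + b)) = (\<lambda>x. tensor_ract x a + tensor_ract x b)"
    by (intro ptensor_eqI bounded_clinear_add bounded_clinear_tensor_ract)
      (simp add: tensor_ract_ptensor distrib_left clinear_add[OF clinear_ptensor_right])
  then show "tensor_ract x (a + b) = tensor_ract x a + tensor_ract x b" by metis
  have "(\<lambda>x. tensor_ract x (c *\<^sub>C a)) = (\<lambda>x. c *\<^sub>C tensor_ract x a)"
    by (intro ptensor_eqI bounded_clinear_scaleC bounded_clinear_tensor_ract)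
      (simp add: tensor_ract_ptensor scaleC_mult_right clinear_scaleC[OF clinear_ptensor_right])
  then show "tensor_ract x (c *\<^sub>C a) = c *\<^sub>C tensor_ract x a" by metis
qed

lemma clinear_tensor_lact: "clinear (\<lambda>a::'a::complex_banach_algebra. tensor_lact a x)"
  unfolding clinear_def
proof (intro conjI allI)
  fix a b :: 'a and c
  have "tensor_lact (a + b) = (\<lambda>x. tensor_lact a x + tensor_lact b x)"
    by (intro ptensor_eqI bounded_clinear_add bounded_clinear_tensor_lact)
      (simp add: tensor_lact_ptensor distrib_right clinear_add[OF clinear_ptensor_left])
  then show "tensor_lact (a + b) x = tensor_lact a x + tensor_lact b x" by metis
  have "tensor_lact (c *\<^sub>C a) = (\<lambda>x. c *\<^sub>C tensor_lact a x)"
    by (intro ptensor_eqI bounded_clinear_scaleC bounded_clinear_tensor_lact)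
      (simp add: tensor_lact_ptensor scaleC_mult_left clinear_scaleC[OF clinear_ptensor_left])
  then show "tensor_lact (c *\<^sub>C a) x = c *\<^sub>C tensor_lact a x" by metis
qed

lemmas tensor_dual_lact_apply = dual_lact_apply[of tensor_ract, OF bounded_clinear_tensor_ract]
lemmas tensor_dual_ract_apply = dual_ract_apply[of tensor_lact, OF bounded_clinear_tensor_lact]
lemmas mult_dual_lact_apply = dual_lact_apply[of "(*)", OF bounded_clinear_mult_right]
lemmas mult_dual_ract_apply = dual_ract_apply[of "(*)", OF bounded_clinear_mult_left]

lemma norm_dual_lact_le: "norm (dual_lact tensor_ract a l) \<le> norm a * norm l"
proof (rule norm_dual_le)
  fix x
  show "norm (dual_apply (dual_lact tensor_ract a l) x) \<le> norm a * norm l * norm x"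
    using order_trans[OF norm_dual_apply_le mult_left_mono[OF norm_tensor_ract_le norm_ge_zero]]
    by (simp add: tensor_dual_lact_apply ac_simps)
qed simp

lemma norm_dual_ract_le: "norm (dual_ract tensor_lact l a) \<le> norm a * norm l"
proof (rule norm_dual_le)
  fix x
  show "norm (dual_apply (dual_ract tensor_lact l a) x) \<le> norm a * norm l * norm x"
    using order_trans[OF norm_dual_apply_le mult_left_mono[OF norm_tensor_lact_le norm_ge_zero]]
    by (simp add: tensor_dual_ract_apply ac_simps)
qed simp

lemma bounded_clinear_dual_lact: "bounded_clinear (\<lambda>a. dual_lact tensor_ract a l)"
  unfolding bounded_clinear_def
proof
  show "clinear (\<lambda>a. dual_lact tensor_ract a l)"
    unfolding clinear_def
    by (auto intro!: dual_eqI simp: tensor_dual_lact_apply plus_dual.rep_eq scaleC_dual.rep_eq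
        scaleC_complex_def clinear_add[OF clinear_tensor_ract] clinear_scaleC[OF clinear_tensor_ract]
        clinear_add[OF clinear_dual_apply] clinear_scaleC[OF clinear_dual_apply])
  show "\<exists>K. \<forall>a. norm (dual_lact tensor_ract a l) \<le> K * norm a"
    using norm_dual_lact_le by (auto simp: mult.commute intro!: exI[of _ "norm l"])
qed

lemma bounded_clinear_dual_ract: "bounded_clinear (dual_ract tensor_lact l)"
  unfolding bounded_clinear_def
proof
  show "clinear (dual_ract tensor_lact l)"
    unfolding clinear_def
    by (auto intro!: dual_eqI simp: tensor_dual_ract_apply plus_dual.rep_eq scaleC_dual.rep_eq
        scaleC_complex_def clinear_add[OF clinear_tensor_lact] clinear_scaleC[OF clinear_tensor_lact]
        clinear_add[OF clinear_dual_apply] clinear_scaleC[OF clinear_dual_apply])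
  show "\<exists>K. \<forall>a. norm (dual_ract tensor_lact l a) \<le> K * norm a"
    using norm_dual_ract_le by (auto simp: mult.commute intro!: exI[of _ "norm l"])
qed


section \<open>Biflatness and \<open>\<sigma>\<close>-biflatness\<close>

lemma biflat_imp_sigma_biflat:
  fixes \<sigma> :: "'a::complex_banach_algebra \<Rightarrow> 'a"
  assumes \<sigma>: "\<sigma> \<in> continuous_homs" and "biflat TYPE('a)"
  shows "sigma_biflat \<sigma>"
proof -
  have mult: "\<sigma> (x * y) = \<sigma> x * \<sigma> y" for x y
    using \<sigma> by (simp add: continuous_homs_def)
  note bounded = continuous_homs_bounded_clinear[OF \<sigma>]
  obtain \<rho> :: "('a, 'a) ptensor dual \<Rightarrow> 'a dual" where \<rho>: "bounded_clinear \<rho>"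
      "\<And>a l. \<rho> (dual_lact tensor_ract a l) = dual_lact (*) a (\<rho> l)"
      "\<And>a l. \<rho> (dual_ract tensor_lact l a) = dual_ract (*) (\<rho> l) a"
      "\<And>f. \<rho> (dual_map diagonal_operator f) = f"
    using assms(2) unfolding biflat_def by blast
  show ?thesis
    unfolding sigma_biflat_def
    by (intro exI[of _ "\<lambda>l. dual_map \<sigma> (\<rho> l)"] conjI allI
        bounded_clinear_compose[OF bounded_clinear_dual_map[OF bounded] \<rho>(1)])
      (auto intro!: dual_eqI
        simp: \<rho>(2-) dual_map_apply[OF bounded] mult_dual_lact_apply mult_dual_ract_apply mult)
qed

text \<open>
  The functionals \<open>\<rho>(\<lambda>)\<close> are controlled by \<open>\<sigma>\<close>: in particular they vanish on its kernel.
\<close>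

lemma sigma_biflat_bound:
  fixes \<rho> :: "('a::complex_banach_algebra, 'a) ptensor dual \<Rightarrow> 'a dual" and \<sigma> :: "'a \<Rightarrow> 'a"
  assumes \<rho>: "bounded_clinear \<rho>"
    and lact: "\<And>a l. \<rho> (dual_lact tensor_ract (\<sigma> a) l) = dual_lact (*) a (\<rho> l)"
    and "has_bounded_approximate_identity TYPE('a)"
  obtains K where "K \<ge> 0" "\<And>l a. norm (dual_apply (\<rho> l) a) \<le> K * norm l * norm (\<sigma> a)"
proof -
  obtain F :: "'a filter" and M where F: "F \<noteq> bot" "\<forall>\<^sub>F e in F. norm e \<le> M"
      "\<And>a. ((\<lambda>e. e * a) \<longlongrightarrow> a) F"
    using assms(3) unfolding has_bounded_approximate_identity_def by blast
  obtain C where C: "C \<ge> 0" "\<And>l. norm (\<rho> l) \<le> C * norm l"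
    using bounded_linear.nonneg_bounded[OF bounded_clinear_bounded_linear[OF \<rho>]]
    by (auto simp: mult.commute)
  have "norm (dual_apply (\<rho> l) a) \<le> C * \<bar>M\<bar> * norm l * norm (\<sigma> a)" for l a
  proof (rule tendsto_upperbound[OF _ _ F(1)])
    show "((\<lambda>e. norm (dual_apply (\<rho> l) (e * a))) \<longlongrightarrow> norm (dual_apply (\<rho> l) a)) F"
      by (intro tendsto_norm bounded_linear.tendsto[OF bounded_clinear_bounded_linear
            [OF bounded_clinear_dual_apply]] F(3))
    show "\<forall>\<^sub>F e in F. norm (dual_apply (\<rho> l) (e * a)) \<le> C * \<bar>M\<bar> * norm l * norm (\<sigma> a)"
      using F(2)
    proof eventually_elim
      case (elim e)
      have "norm (dual_apply (\<rho> l) (e * a)) = norm (dual_apply (\<rho> (dual_lact tensor_ract (\<sigma> a) l)) e)"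
        by (simp add: lact mult_dual_lact_apply)
      also have "\<dots> \<le> norm (\<rho> (dual_lact tensor_ract (\<sigma> a) l)) * norm e"
        by (rule norm_dual_apply_le)
      also have "\<dots> \<le> (C * (norm (\<sigma> a) * norm l)) * \<bar>M\<bar>"
        using elim C(1)
        by (intro mult_mono order_trans[OF C(2) mult_left_mono[OF norm_dual_lact_le]]) auto
      finally show ?case by (simp add: ac_simps)
    qed
  qed
  then show ?thesis
    using C(1) by (intro that[of "C * \<bar>M\<bar>"]) auto
qed

lemma sigma_biflat_imp_biflat:
  fixes \<sigma> :: "'a::complex_banach_algebra \<Rightarrow> 'a"
  assumes \<sigma>: "\<sigma> \<in> continuous_homs" and "sigma_biflat \<sigma>"
    and bai: "has_bounded_approximate_identity TYPE('a)" and dense: "closure (range \<sigma>) = UNIV"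
  shows "biflat TYPE('a)"
proof -
  have mult: "\<sigma> x * \<sigma> y = \<sigma> (x * y)" for x y
    using \<sigma> by (simp add: continuous_homs_def)
  note bounded = continuous_homs_bounded_clinear[OF \<sigma>]
  obtain \<rho> :: "('a, 'a) ptensor dual \<Rightarrow> 'a dual" where \<rho>: "bounded_clinear \<rho>"
      and lact: "\<And>a l. \<rho> (dual_lact tensor_ract (\<sigma> a) l) = dual_lact (*) a (\<rho> l)"
      and ract: "\<And>a l. \<rho> (dual_ract tensor_lact l (\<sigma> a)) = dual_ract (*) (\<rho> l) a"
      and diag: "\<And>f. \<rho> (dual_map diagonal_operator f) = dual_map \<sigma> f"
    using assms(2) unfolding sigma_biflat_def by blast
  obtain K where K: "K \<ge> 0" "\<And>l a. norm (dual_apply (\<rho> l) a) \<le> K * norm l * norm (\<sigma> a)"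
    by (rule sigma_biflat_bound[OF \<rho> lact bai]) blast
  have "\<exists>g. (\<forall>a. dual_apply g (\<sigma> a) = dual_apply (\<rho> l) a) \<and> norm g \<le> K * norm l" for l
  proof -
    obtain U where U: "bounded_clinear U" "\<And>a. U (\<sigma> a) = dual_apply (\<rho> l) a"
        "\<And>y. norm (U y) \<le> K * norm l * norm y"
      by (rule dense_range_factorization[OF bounded_clinear_clinear[OF bounded]
            clinear_dual_apply dense K(2)]) blast
    have "dual_apply (Dual U) = U"
      using U(1) by (simp add: Dual_inverse)
    with U K(1) show ?thesis
      by (intro exI[of _ "Dual U"]) (auto intro: norm_dual_le)
  qed
  then obtain \<tau> where \<tau>: "\<And>l a. dual_apply (\<tau> l) (\<sigma> a) = dual_apply (\<rho> l) a"
      and \<tau>_bound: "\<And>l. norm (\<tau> l) \<le> K * norm l"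
    by metis
  have eqI: "f = g" if "\<And>a. dual_apply f (\<sigma> a) = dual_apply g (\<sigma> a)" for f g
    using continuous_eq_on_dense_range[OF dual_apply_continuous dual_apply_continuous dense] that
    by (intro dual_eqI) blast
  have "clinear \<tau>"
    using bounded_clinear_clinear[OF \<rho>]
    by (auto intro!: eqI simp: clinear_def \<tau> plus_dual.rep_eq scaleC_dual.rep_eq)
  then have bounded_\<tau>: "bounded_clinear \<tau>"
    using \<tau>_bound unfolding bounded_clinear_def by blast
  have cont: "continuous_on UNIV (\<lambda>x. dual_apply (\<tau> (h x)) y)"
    if "bounded_clinear h" for h :: "'a \<Rightarrow> ('a, 'a) ptensor dual" and y
    by (intro linear_continuous_on bounded_linear_compose[OF bounded_linear_dual_apply_left]
        bounded_clinear_bounded_linear bounded_clinear_compose[OF bounded_\<tau> that])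
  have cont_mult: "continuous_on UNIV (\<lambda>x. dual_apply f (x * y))"
      "continuous_on UNIV (\<lambda>x. dual_apply f (y * x))" for f and y :: 'a
    by (auto intro!: continuous_on_compose2[OF dual_apply_continuous] continuous_intros)
  have "\<tau> (dual_lact tensor_ract x l) = dual_lact (*) x (\<tau> l)" for x l
  proof (rule eqI)
    fix a
    have "dual_apply (\<tau> (dual_lact tensor_ract x l)) (\<sigma> a) = dual_apply (\<tau> l) (\<sigma> a * x)"
      by (rule continuous_eq_on_dense_range[OF cont[OF bounded_clinear_dual_lact] cont_mult(2) dense])
        (simp add: mult \<tau> lact mult_dual_lact_apply)
    then show "dual_apply (\<tau> (dual_lact tensor_ract x l)) (\<sigma> a) = dual_apply (dual_lact (*) x (\<tau> l)) (\<sigma> a)"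
      by (simp add: mult_dual_lact_apply)
  qed
  moreover have "\<tau> (dual_ract tensor_lact l x) = dual_ract (*) (\<tau> l) x" for x l
  proof (rule eqI)
    fix a
    have "dual_apply (\<tau> (dual_ract tensor_lact l x)) (\<sigma> a) = dual_apply (\<tau> l) (x * \<sigma> a)"
      by (rule continuous_eq_on_dense_range[OF cont[OF bounded_clinear_dual_ract] cont_mult(1) dense])
        (simp add: mult \<tau> ract mult_dual_ract_apply)
    then show "dual_apply (\<tau> (dual_ract tensor_lact l x)) (\<sigma> a) = dual_apply (dual_ract (*) (\<tau> l) x) (\<sigma> a)"
      by (simp add: mult_dual_ract_apply)
  qed
  moreover have "\<tau> (dual_map diagonal_operator f) = f" for f
    by (rule eqI) (simp add: \<tau> diag dual_map_apply[OF bounded])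
  ultimately show ?thesis
    unfolding biflat_def using bounded_\<tau> by blast
qed

theorem proposition2p5:
  fixes \<sigma> :: "'a::complex_banach_algebra \<Rightarrow> 'a"
  assumes "\<sigma> \<in> continuous_homs"
  shows "(biflat TYPE('a) \<longrightarrow> sigma_biflat \<sigma>) \<and>
    (sigma_biflat \<sigma> \<and> has_bounded_approximate_identity TYPE('a) \<and> closure (range \<sigma>) = UNIV
      \<longrightarrow> biflat TYPE('a))"
  using biflat_imp_sigma_biflat[OF assms] sigma_biflat_imp_biflat[OF assms] by blast

end
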